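(* There exists an absolute constant $C>0$ such that for every $\delta\in(0,1)$, $$\inf_{\mu}\Big(\inf\big\{\mathbb{E}_{\mu^N}[\mu((1+\delta)K_N)] : N\geq \exp\big(C\delta^{-1}\ln(2/\delta)\,n\ln n\big)\big\}\Big)\longrightarrow 1\quad\text{as } n\to\infty,$$ where the outer infimum is over all log-concave probability measures $\mu$ on $\mathbb{R}^n$ with barycenter at the origin, and $K_N=\mathrm{conv}\{X_1,\ldots,X_N\}$ with $X_1,X_2,\ldots$ independent random points distributed according to $\mu$.
   Context: A log-concave probability measure on $\mathbb{R}^n$ is a Borel probability measure $\mu$ such that $\mu(\lambda A+(1-\lambda)B)\geq \mu(A)^{\lambda}\mu(B)^{1-\lambda}$ for all compact $A,B$ and $\lambda\in(0,1)$, and $\mu(H)<1$ for every hyperplane $H$. *)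

theory Defs
  imports "HOL-Probability.Probability"
begin

text \<open>R^n is represented inside the type nat => real (product topology, Borel sets)
  as the closed subspace of vectors vanishing at every index >= n.\<close>

definition Rn :: "nat \<Rightarrow> (nat \<Rightarrow> real) set" where
  "Rn n = {x. \<forall>i\<ge>n. x i = 0}"

definition minkowski_comb :: "real \<Rightarrow> (nat \<Rightarrow> real) set \<Rightarrow> (nat \<Rightarrow> real) set \<Rightarrow> (nat \<Rightarrow> real) set" where
  "minkowski_comb l A B = {(\<lambda>i. l * a i + (1 - l) * b i) | a b. a \<in> A \<and> b \<in> B}"

definition hyperplane_Rn :: "nat \<Rightarrow> (nat \<Rightarrow> real) \<Rightarrow> real \<Rightarrow> (nat \<Rightarrow> real) set" where
  "hyperplane_Rn n a c = {x \<in> Rn n. (\<Sum>i<n. a i * x i) = c}"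

definition log_concave_prob :: "nat \<Rightarrow> (nat \<Rightarrow> real) measure \<Rightarrow> bool" where
  "log_concave_prob n \<mu> \<longleftrightarrow>
     prob_space \<mu> \<and> sets \<mu> = sets borel \<and> measure \<mu> (Rn n) = 1 \<and>
     (\<forall>A B l. compact A \<and> compact B \<and> A \<subseteq> Rn n \<and> B \<subseteq> Rn n \<and> 0 < l \<and> l < 1 \<longrightarrow>
        measure \<mu> (minkowski_comb l A B) \<ge> measure \<mu> A powr l * measure \<mu> B powr (1 - l)) \<and>
     (\<forall>a c. (\<exists>i<n. a i \<noteq> 0) \<longrightarrow> measure \<mu> (hyperplane_Rn n a c) < 1)"

definition barycenter_origin :: "nat \<Rightarrow> (nat \<Rightarrow> real) measure \<Rightarrow> bool" where
  "barycenter_origin n \<mu> \<longleftrightarrow>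
     (\<forall>i<n. integrable \<mu> (\<lambda>x. x i) \<and> (\<integral>x. x i \<partial>\<mu>) = 0)"

definition scaled_hull :: "real \<Rightarrow> nat \<Rightarrow> (nat \<Rightarrow> nat \<Rightarrow> real) \<Rightarrow> (nat \<Rightarrow> real) set" where
  "scaled_hull t N X = {(\<lambda>i. t * (\<Sum>j<N. w j * X j i)) | w.
      (\<forall>j<N. 0 \<le> w j) \<and> (\<Sum>j<N. w j) = 1}"

definition expected_cover :: "(nat \<Rightarrow> real) measure \<Rightarrow> nat \<Rightarrow> real \<Rightarrow> real" where
  "expected_cover \<mu> N d =
     (\<integral>X. measure \<mu> (scaled_hull (1 + d) N X) \<partial>(PiM {..<N} (\<lambda>_. \<mu>)))"

end

theory Submission
  imports Defs
begin

text \<open>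
  Fix \<open>\<mu>\<close> and choose coordinates in which \<open>\<mu>\<close> is isotropic. Let \<open>T\<close> be a grid of \<open>n\<^bsup>O(n)\<^esup>\<close> directions,
  and for each \<open>b \<in> T\<close> let \<open>s b\<close> be the \<open>q\<close>-quantile of \<open>\<langle>b, \<cdot>\<rangle>\<close> under \<open>\<mu>\<close> truncated to a ball of polynomial
  radius, with \<open>q\<close> a little smaller than the inverse of the size of \<open>T\<close>. A union bound over \<open>T\<close> shows that
  most points \<open>x\<close> satisfy \<open>\<langle>b, x\<rangle> \<le> s b\<close> for all \<open>b\<close>, while most samples contain for every \<open>b\<close> a bounded
  point \<open>X j\<close> with \<open>\<langle>b, X j\<rangle> \<ge> s b\<close>. If such an \<open>x\<close> could be separated from \<open>(1 + \<delta>) K\<^sub>N\<close> by a unit direction,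
  rounding that direction to \<open>T\<close> would give a contradiction, because the factor \<open>1 + \<delta>\<close> absorbs the rounding error.
  Log-concavity enters only through Borell's lemma: it makes the first two moments of a linear
  functional comparable, so that every half-space at a constant distance from the barycenter carries constant mass.

  The infimum over an empty family is a junk value, so a centered log-concave measure must exist in every
  dimension; the uniform measure on the cube is one by the Prekopa--Leindler inequality.
\<close>

subsection \<open>Prekopa--Leindler inequality and the uniform measure on the cube\<close>

text \<open>Rounding a direction costs an additive error \<open>R / m\<close> on points of gauge at
  most \<open>R\<close>, whereas the factor \<open>1 + d\<close> yields only a multiplicative gain.
  The two can be compared only if the relevant quantiles are bounded below by an absolute constant;
  hence the need for moment comparisons with constants free of \<open>n\<close> and \<mu>, and for
  truncation before rounding. Grid vectors with possibly small quantiles are discarded, and the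
  rounding of a unit vector is never among them. The measure is not moved to isotropic position:
  functionals orthonormal in L^2(\<mu>) are fixed, and their coefficient vectors play the role of
  directions. For fixed \<open>d\<close> the choice \<open>R = n^2\<close>, \<open>m = n^4\<close>
  eventually makes the error smaller than the gain. The grid then has at most
  \<open>n ^ (5 * n)\<close> vectors, the quantile level is \<open>1 / n ^ (6 * n)\<close>, and
  \<open>n ^ (12 * n)\<close> sample points reach every cap.\<close>

lemma lmeasurable_affine_image_real:
  fixes S :: "real set"
  assumes S: "S \<in> lmeasurable" and k: "k \<noteq> 0"
  shows "(\<lambda>x. k * x + c) ` S \<in> lmeasurable"
proof -
  have "(\<lambda>x. k *\<^sub>R x) ` S = (\<lambda>x. (1 / k) *\<^sub>R x) -` S \<inter> space lebesgue"
    using k by (force simp: image_iff field_simps)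
  also have "\<dots> \<in> sets lebesgue"
    using S by (intro measurable_sets[OF lebesgue_measurable_scaling]) auto
  finally have "(\<lambda>x. k *\<^sub>R x) ` S \<in> sets lebesgue" .
  moreover have "emeasure lebesgue ((\<lambda>x. k *\<^sub>R x) ` S) < \<infinity>"
    using emeasure_lebesgue_affine[of k 0 S] S 
    by (simp add: fmeasurable_def ennreal_mult_less_top del: emeasure_completion)
  ultimately have "(\<lambda>x. k *\<^sub>R x) ` S \<in> lmeasurable"
    by (simp add: fmeasurable_def)
  from measurable_translation[OF this, of c] show ?thesis
    by (simp add: image_image add.commute)
qed

text \<open>The translates \<open>l * A + (1 - l) * b\<close> and \<open>l * a + (1 - l) * B\<close>
  both lie in \<open>C\<close>. For \<open>a\<close> near \<open>Sup A\<close> and \<open>b\<close>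
  near \<open>Inf B\<close> they overlap in an interval of length at most \<open>e\<close>.
  \<open>C\<close> is a measurable superset because a Minkowski sum of measurable sets may fail to
  be measurable.\<close>

lemma brunn_minkowski_real:
  fixes A B C :: "real set"
  assumes meas: "A \<in> lmeasurable" "B \<in> lmeasurable" "C \<in> lmeasurable"
    and ne: "A \<noteq> {}" "B \<noteq> {}" and bdd: "bdd_above A" "bdd_below B"
    and l: "0 < l" "l < 1"
    and sub: "\<And>a b. a \<in> A \<Longrightarrow> b \<in> B \<Longrightarrow> l * a + (1 - l) * b \<in> C"
  shows "l * measure lebesgue A + (1 - l) * measure lebesgue B \<le> measure lebesgue C"
proof (rule field_le_epsilon)
  fix e :: real assume e: "0 < e"
  obtain a where a: "a \<in> A" "Sup A - e < a"
    using less_cSupE[of "Sup A - e" A] ne e by auto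
  obtain b where b: "b \<in> B" "b < Inf B + e"
    using cInf_lessD[of B "Inf B + e"] ne e by auto
  define A' where "A' = (\<lambda>x. l *\<^sub>R x + (1 - l) * b) ` A"
  define B' where "B' = (\<lambda>y. (1 - l) *\<^sub>R y + l * a) ` B"
  have mA: "measure lebesgue A' = l * measure lebesgue A"
    using l unfolding A'_def by (subst measure_lebesgue_affine) auto
  have mB: "measure lebesgue B' = (1 - l) * measure lebesgue B"
    using l unfolding B'_def by (subst measure_lebesgue_affine) auto
  have lA: "A' \<in> lmeasurable" and lB: "B' \<in> lmeasurable"
    unfolding A'_def B'_def using meas l by (auto intro!: lmeasurable_affine_image_real)
  have sub': "A' \<union> B' \<subseteq> C"
    using sub a b unfolding A'_def B'_def by (auto simp: algebra_simps)
  have "measure lebesgue (A' \<inter> B') \<le> measure lebesgue {l * a + (1 - l) * Inf B .. l * Sup A + (1 - l) * b}"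
  proof (rule measure_mono_fmeasurable)
    show "A' \<inter> B' \<subseteq> {l * a + (1 - l) * Inf B .. l * Sup A + (1 - l) * b}"
    proof
      fix z assume "z \<in> A' \<inter> B'"
      then obtain x where x: "x \<in> A" "z = l * x + (1 - l) * b"
        unfolding A'_def by auto
      from \<open>z \<in> A' \<inter> B'\<close> obtain y where y: "y \<in> B" "z = (1 - l) * y + l * a"
        unfolding B'_def by auto
      have "l * x \<le> l * Sup A" "(1 - l) * Inf B \<le> (1 - l) * y"
        using l bdd x y by (auto intro!: cInf_lower cSup_upper mult_left_mono)
      with x(2) y(2) show "z \<in> {l * a + (1 - l) * Inf B .. l * Sup A + (1 - l) * b}" by auto
    qed
  qed (use lA lB in auto)
  also have "\<dots> \<le> e"
  proof -
    have "l * (Sup A - a) + (1 - l) * (b - Inf B) \<le> l * e + (1 - l) * e"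
      using a b l by (intro add_mono mult_left_mono) auto
    then show ?thesis using e by (simp add: algebra_simps)
  qed
  finally have i: "measure lebesgue (A' \<inter> B') \<le> e" .
  have "measure lebesgue (A' \<union> B') = measure lebesgue A' + measure lebesgue B' - measure lebesgue (A' \<inter> B')"
    using lA lB by (rule measure_Un3)
  moreover have "measure lebesgue (A' \<union> B') \<le> measure lebesgue C"
    using lA lB meas sub' by (intro measure_mono_fmeasurable) auto
  ultimately show "l * measure lebesgue A + (1 - l) * measure lebesgue B \<le> measure lebesgue C + e"
    using i mA mB by linarith
qed

text \<open>Only levels below 1 are integrated, since those are the levels at which the normalized
  functions are known to have nonempty superlevel sets. The price is the truncation at 1.\<close>

lemma nn_integral_min_layer_cake:
  fixes f :: "'a \<Rightarrow> real"
  assumes "sigma_finite_measure M" and f[measurable]: "f \<in> borel_measurable M"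
    and f0: "\<And>x. 0 \<le> f x"
  shows "(\<integral>\<^sup>+t. indicator {0<..<1} t * emeasure M {x \<in> space M. t < f x} \<partial>lborel)
       = (\<integral>\<^sup>+x. ennreal (min (f x) 1) \<partial>M)"
proof -
  interpret sigma_finite_measure M by fact
  interpret pair_sigma_finite M lborel ..
  have "(\<integral>\<^sup>+t. indicator {0<..<1} t * emeasure M {x \<in> space M. t < f x} \<partial>lborel)
      = (\<integral>\<^sup>+t. (\<integral>\<^sup>+x. indicator {0<..<1} t * indicator {x \<in> space M. t < f x} x \<partial>M) \<partial>lborel)"
    by (intro nn_integral_cong) (simp add: nn_integral_cmult)
  also have "\<dots> = (\<integral>\<^sup>+t. (\<integral>\<^sup>+x. indicator {0<..<min (f x) 1} t \<partial>M) \<partial>lborel)"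
    by (intro nn_integral_cong) (auto split: split_indicator)
  also have "\<dots> = (\<integral>\<^sup>+x. (\<integral>\<^sup>+t. indicator {0<..<min (f x) 1} t \<partial>lborel) \<partial>M)"
  proof (rule Fubini')
    have "Measurable.pred (M \<Otimes>\<^sub>M lborel) (\<lambda>z. 0 < snd z \<and> snd z < min (f (fst z)) 1)"
      by measurable
    then show "(\<lambda>(x, t). indicator {0<..<min (f x) 1} t :: ennreal) \<in> borel_measurable (M \<Otimes>\<^sub>M lborel)"
      by (simp add: indicator_def case_prod_beta)
  qed
  also have "\<dots> = (\<integral>\<^sup>+x. ennreal (min (f x) 1) \<partial>M)"
    using f0 by (intro nn_integral_cong) simp
  finally show ?thesis .
qed

definition unif :: "real measure" where
  "unif = uniform_measure lborel {-1..1}"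

lemma prob_space_unif: "prob_space unif"
  unfolding unif_def by (rule prob_space_uniform_measure) auto

lemma sets_unif [simp, measurable_cong]: "sets unif = sets borel"
  by (simp add: unif_def)

lemma space_unif [simp]: "space unif = UNIV"
  by (simp add: unif_def)

lemma measure_unif:
  assumes "A \<in> sets borel"
  shows "measure unif A = measure lebesgue (A \<inter> {-1..1}) / 2"
  using assms unfolding unif_def
  by (subst measure_uniform_measure) (auto simp: Int_commute)

lemma AE_unif: "AE t in unif. t \<in> {-1..1}"
  unfolding unif_def by (rule AE_uniform_measureI) auto

text \<open>Both traces on the interval must be nonempty: with \<open>A\<close> empty,
  \<open>sub\<close> is vacuous although the left side may be positive. Convexity keeps combinations
  inside the interval.\<close>

lemma brunn_minkowski_unif:
  fixes A B C :: "real set"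
  assumes [measurable]: "A \<in> sets borel" "B \<in> sets borel" "C \<in> sets borel"
    and ne: "A \<inter> {-1..1} \<noteq> {}" "B \<inter> {-1..1} \<noteq> {}"
    and l: "0 < l" "l < 1"
    and sub: "\<And>a b. a \<in> A \<Longrightarrow> b \<in> B \<Longrightarrow> l * a + (1 - l) * b \<in> C"
  shows "l * measure unif A + (1 - l) * measure unif B \<le> measure unif C"
proof -
  have lm: "S \<inter> {-1..1} \<in> lmeasurable" if "S \<in> sets borel" for S :: "real set"
    using that by (intro bounded_set_imp_lmeasurable) auto
  have "l * measure lebesgue (A \<inter> {-1..1}) + (1 - l) * measure lebesgue (B \<inter> {-1..1})
      \<le> measure lebesgue (C \<inter> {-1..1})"
  proof (rule brunn_minkowski_real[OF lm lm lm ne _ _ l])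
    fix a b assume ab: "a \<in> A \<inter> {-1..1}" "b \<in> B \<inter> {-1..1}"
    have "l *\<^sub>R a + (1 - l) *\<^sub>R b \<in> {-1..1::real}"
      using ab l by (intro convexD) auto
    then show "l * a + (1 - l) * b \<in> C \<inter> {-1..1}" using ab sub by simp
  qed (auto intro: bdd_above_Int2 bdd_below_Int2)
  then show ?thesis by (simp add: measure_unif field_simps)
qed

lemma measurable_emeasure_superlevel:
  fixes f :: "'a \<Rightarrow> real"
  assumes "sigma_finite_measure M" and [measurable]: "f \<in> borel_measurable M"
  shows "(\<lambda>t. emeasure M {x \<in> space M. t < f x}) \<in> borel_measurable lborel"
proof -
  interpret sigma_finite_measure M by fact
  have "{z \<in> space (lborel \<Otimes>\<^sub>M M). fst z < f (snd z)} \<in> sets (lborel \<Otimes>\<^sub>M M)"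
    by measurable
  from measurable_emeasure_Pair[OF this] show ?thesis
    by (rule measurable_cong[THEN iffD1, rotated])
       (auto intro!: arg_cong[where f = "emeasure M"] simp: space_pair_measure)
qed

text \<open>Dividing by the suprema over the support makes every level set below 1 nonempty, so the
  one-dimensional Brunn--Minkowski inequality applies level by level.\<close>

lemma prekopa_leindler_unif:
  fixes f g h :: "real \<Rightarrow> real"
  assumes [measurable]: "f \<in> borel_measurable borel" "g \<in> borel_measurable borel" "h \<in> borel_measurable borel"
    and f: "\<And>x. f x \<in> {0..1}" and g: "\<And>x. g x \<in> {0..1}" and h: "\<And>x. h x \<in> {0..1}"
    and l: "0 < l" "l < 1"
    and fgh: "\<And>x y. f x powr l * g y powr (1 - l) \<le> h (l * x + (1 - l) * y)"
  shows "(\<integral>x. f x \<partial>unif) powr l * (\<integral>x. g x \<partial>unif) powr (1 - l) \<le> (\<integral>x. h x \<partial>unif)"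
proof -
  interpret U: prob_space unif by (rule prob_space_unif)
  let ?I = "{-1..1::real}"
  have int: "integrable unif u" if "u \<in> borel_measurable borel" "\<And>x. u x \<in> {0..1}" for u :: "real \<Rightarrow> real"
    using that by (intro U.integrable_const_bound[where B=1]) (auto simp: measurable_cong_sets[OF sets_unif refl])
  have h0: "0 \<le> (\<integral>x. h x \<partial>unif)" using h by (intro integral_nonneg_AE) auto
  have sup: "0 < Sup (u ` ?I)" "\<And>x. x \<in> ?I \<Longrightarrow> u x \<le> Sup (u ` ?I)"
      "\<And>t. t < 1 \<Longrightarrow> {x. t < u x / Sup (u ` ?I)} \<inter> ?I \<noteq> {}"
    if u: "\<And>x. u x \<in> {0..1}" and nz: "(\<integral>x. u x \<partial>unif) \<noteq> 0" for u :: "real \<Rightarrow> real"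
  proof -
    have bdd: "bdd_above (u ` ?I)" using u by (intro bdd_aboveI[where M=1]) auto
    show le: "u x \<le> Sup (u ` ?I)" if "x \<in> ?I" for x
      using that bdd by (intro cSup_upper) auto
    show pos: "0 < Sup (u ` ?I)"
    proof (rule ccontr)
      assume "\<not> 0 < Sup (u ` ?I)"
      then have "u x = 0" if "x \<in> ?I" for x using le[OF that] u[of x] by auto
      then have "AE x in unif. u x = 0" using AE_unif by (auto elim!: AE_mp)
      then have "(\<integral>x. u x \<partial>unif) = 0" by (simp add: integral_eq_zero_AE)
      with nz show False by simp
    qed
    show "{x. t < u x / Sup (u ` ?I)} \<inter> ?I \<noteq> {}" if t: "t < 1" for t
    proof -
      have "t * Sup (u ` ?I) < Sup (u ` ?I)" using t pos by simp
      then obtain v where "v \<in> u ` ?I" "t * Sup (u ` ?I) < v" by (rule less_cSupE) auto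
      then show ?thesis using pos by (auto simp: field_simps)
    qed
  qed
  show ?thesis
  proof (cases "(\<integral>x. f x \<partial>unif) = 0 \<or> (\<integral>x. g x \<partial>unif) = 0")
    case True
    then show ?thesis using h0 by auto
  next
    case False
    define a where "a = Sup (f ` ?I)"
    define b where "b = Sup (g ` ?I)"
    define c where "c = a powr l * b powr (1 - l)"
    note sf = sup[of f, folded a_def] and sg = sup[of g, folded b_def]
    have a: "0 < a" and b: "0 < b" using sf(1) sg(1) f g False by auto
    then have c: "0 < c" by (simp add: c_def)
    have level: "l * measure unif {x. t < f x / a} + (1 - l) * measure unif {x. t < g x / b}
        \<le> measure unif {x. t < h x / c}" if t: "0 < t" "t < 1" for t
    proof (rule brunn_minkowski_unif[OF _ _ _ _ _ l])
      show "{x. t < f x / a} \<inter> ?I \<noteq> {}" "{x. t < g x / b} \<inter> ?I \<noteq> {}"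
        using sf(3) sg(3) f g False t by auto
      fix x y assume xy: "x \<in> {x. t < f x / a}" "y \<in> {x. t < g x / b}"
      \<comment> \<open>Homogeneity: the thresholds \<open>t * a\<close> and \<open>t * b\<close>
        combine to \<open>t * c\<close>, so all three level sets can be taken at the same
        \<open>t\<close>.\<close>
      have "(t * a) powr l * (t * b) powr (1 - l) < f x powr l * g y powr (1 - l)"
      proof -
        have "0 < t * a" "0 < t * b" "t * a < f x" "t * b < g y"
          using xy t a b by (auto simp: field_simps)
        then show ?thesis
          using l by (intro mult_strict_mono powr_less_mono2) auto
      qed
      also have "(t * a) powr l * (t * b) powr (1 - l) = (t powr l * t powr (1 - l)) * c"
        using t a b by (simp add: powr_mult c_def)
      also have "t powr l * t powr (1 - l) = t"
        using t by (simp add: powr_add[symmetric])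
      also note fgh[of x y]
      finally show "l * x + (1 - l) * y \<in> {x. t < h x / c}"
        using c by (simp add: field_simps)
    qed measurable
    have cake: "(\<integral>\<^sup>+t. indicator {0<..<1} t * emeasure unif {x. t < u x / k} \<partial>lborel)
        = (\<integral>\<^sup>+x. ennreal (min (u x / k) 1) \<partial>unif)" 
      "(\<lambda>t. emeasure unif {x. t < u x / k}) \<in> borel_measurable borel"
      if "u \<in> borel_measurable borel" "\<And>x. u x \<in> {0..1}" "0 < k" for u :: "real \<Rightarrow> real" and k
    proof -
      have [measurable]: "u \<in> borel_measurable borel" by fact
      have sf: "sigma_finite_measure unif" ..
      have "0 \<le> u x" for x using that(2)[of x] by simp
      then show "(\<integral>\<^sup>+t. indicator {0<..<1} t * emeasure unif {x. t < u x / k} \<partial>lborel)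
          = (\<integral>\<^sup>+x. ennreal (min (u x / k) 1) \<partial>unif)"
        using nn_integral_min_layer_cake[OF sf, of "\<lambda>x. u x / k"] that(3) by simp
      show "(\<lambda>t. emeasure unif {x. t < u x / k}) \<in> borel_measurable borel"
        using measurable_emeasure_superlevel[OF sf, of "\<lambda>x. u x / k"] by simp
    qed
    \<comment> \<open>Truncation loses nothing for \<open>f\<close> and \<open>g\<close>, which stay
      below their suprema on the support. For \<open>h\<close> the inequality
      \<open>min (h x / c) 1 \<le> h x / c\<close> is enough.\<close>
    have full: "(\<integral>\<^sup>+x. ennreal (min (u x / k) 1) \<partial>unif) = ennreal ((\<integral>x. u x \<partial>unif) / k)"
      if "u \<in> borel_measurable borel" "\<And>x. u x \<in> {0..1}" "0 < k" "\<And>x. x \<in> ?I \<Longrightarrow> u x \<le> k" for u :: "real \<Rightarrow> real" and k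
    proof -
      have "(\<integral>\<^sup>+x. ennreal (min (u x / k) 1) \<partial>unif) = (\<integral>\<^sup>+x. ennreal (u x / k) \<partial>unif)"
        using AE_unif that(3,4) by (intro nn_integral_cong_AE) (auto elim!: AE_mp simp: min_def field_simps)
      also have "\<dots> = ennreal (\<integral>x. u x / k \<partial>unif)"
        using int[OF that(1,2)] that(2,3) by (intro nn_integral_eq_integral) (auto intro!: AE_I2 divide_nonneg_pos)
      finally show ?thesis by simp
    qed
    have fg0: "0 \<le> (\<integral>x. f x \<partial>unif)" "0 \<le> (\<integral>x. g x \<partial>unif)"
      using f g by (auto intro!: integral_nonneg_AE)
    have "ennreal (l * ((\<integral>x. f x \<partial>unif) / a) + (1 - l) * ((\<integral>x. g x \<partial>unif) / b))
        = ennreal l * ennreal ((\<integral>x. f x \<partial>unif) / a) + ennreal (1 - l) * ennreal ((\<integral>x. g x \<partial>unif) / b)"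
      using l a b fg0 by (subst ennreal_plus) (auto simp: ennreal_mult[symmetric] intro!: mult_nonneg_nonneg divide_nonneg_pos)
    also have "\<dots> = ennreal l * (\<integral>\<^sup>+x. ennreal (min (f x / a) 1) \<partial>unif) + ennreal (1 - l) * (\<integral>\<^sup>+x. ennreal (min (g x / b) 1) \<partial>unif)"
      using full[of f a] full[of g b] f g a b sf(2) sg(2) False by simp
    also have "\<dots> = (\<integral>\<^sup>+t. ennreal l * (indicator {0<..<1} t * emeasure unif {x. t < f x / a})
        + ennreal (1 - l) * (indicator {0<..<1} t * emeasure unif {x. t < g x / b}) \<partial>lborel)"
    proof -
      have [measurable]: "(\<lambda>t. emeasure unif {x. t < f x / a}) \<in> borel_measurable borel"
        "(\<lambda>t. emeasure unif {x. t < g x / b}) \<in> borel_measurable borel"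
        using cake(2)[of f a] cake(2)[of g b] f g a b by auto
      show ?thesis
        using cake(1)[of f a] cake(1)[of g b] f g a b
        by (subst nn_integral_add) (auto simp: nn_integral_cmult)
    qed
    also have "\<dots> \<le> (\<integral>\<^sup>+t. indicator {0<..<1} t * emeasure unif {x. t < h x / c} \<partial>lborel)"
    proof (rule nn_integral_mono)
      fix t :: real
      show "ennreal l * (indicator {0<..<1} t * emeasure unif {x. t < f x / a})
        + ennreal (1 - l) * (indicator {0<..<1} t * emeasure unif {x. t < g x / b})
        \<le> indicator {0<..<1} t * emeasure unif {x. t < h x / c}"
      proof (cases "0 < t \<and> t < 1")
        case True
        then have "ennreal (l * measure unif {x. t < f x / a} + (1 - l) * measure unif {x. t < g x / b})
            \<le> ennreal (measure unif {x. t < h x / c})"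
          using level by (intro ennreal_leI) auto
        then show ?thesis using l True
          by (simp add: U.emeasure_eq_measure ennreal_mult ennreal_plus)
      qed (auto split: split_indicator)
    qed
    also have "\<dots> = (\<integral>\<^sup>+x. ennreal (min (h x / c) 1) \<partial>unif)"
      using cake(1)[of h c] h c by auto
    also have "\<dots> \<le> (\<integral>\<^sup>+x. ennreal (h x / c) \<partial>unif)"
      by (intro nn_integral_mono ennreal_leI) auto
    also have "\<dots> = ennreal (\<integral>x. h x / c \<partial>unif)"
      using int[of h] h c by (intro nn_integral_eq_integral) (auto intro!: AE_I2 divide_nonneg_pos)
    finally have main: "l * ((\<integral>x. f x \<partial>unif) / a) + (1 - l) * ((\<integral>x. g x \<partial>unif) / b) \<le> (\<integral>x. h x \<partial>unif) / c"
      using h0 c by (subst (asm) ennreal_le_iff) auto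
    \<comment> \<open>Weighted AM-GM turns the arithmetic bound \<open>main\<close> into a geometric
      one, and the normalizations cancel by the definition of \<open>c\<close>.\<close>
    have "((\<integral>x. f x \<partial>unif) / a) powr l * ((\<integral>x. g x \<partial>unif) / b) powr (1 - l)
        \<le> l * ((\<integral>x. f x \<partial>unif) / a) + (1 - l) * ((\<integral>x. g x \<partial>unif) / b)"
      using l a b fg0 False by (intro Youngs_inequality_0) (auto simp: less_le)
    also note main
    finally show ?thesis using c a b fg0
      by (simp add: powr_divide c_def field_simps)
  qed
qed

text \<open>Overwriting one coordinate at a time keeps the measure on the Borel sets of
  \<open>nat \<Rightarrow> real\<close>, as \<open>log_concave_prob\<close> demands, and lets its
  properties follow from Fubini by induction on the dimension.\<close>

primrec cube_measure :: "nat \<Rightarrow> (nat \<Rightarrow> real) measure" where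
  "cube_measure 0 = return borel (\<lambda>_. 0)"
| "cube_measure (Suc n) = distr (cube_measure n \<Otimes>\<^sub>M unif) borel (\<lambda>(x, t). x(n := t))"

lemma measurable_fun_upd_borel [measurable]:
  "(\<lambda>(x :: nat \<Rightarrow> real, t). x(n := t)) \<in> borel_measurable (borel \<Otimes>\<^sub>M borel)"
proof -
  have "continuous_on UNIV (\<lambda>z :: (nat \<Rightarrow> real) \<times> real. (fst z)(n := snd z))"
  proof (rule continuous_on_coordinatewise_then_product)
    fix i
    show "continuous_on UNIV (\<lambda>z :: (nat \<Rightarrow> real) \<times> real. ((fst z)(n := snd z)) i)"
      by (cases "i = n") (auto intro!: continuous_intros continuous_on_product_then_coordinatewise[OF continuous_on_fst])
  qed
  then have "(\<lambda>z :: (nat \<Rightarrow> real) \<times> real. (fst z)(n := snd z)) \<in> borel_measurable borel"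
    by (rule borel_measurable_continuous_onI)
  then show ?thesis by (simp add: borel_prod case_prod_beta)
qed

lemma sets_cube_measure [simp, measurable_cong]: "sets (cube_measure n) = sets borel"
  by (cases n) auto

lemma space_cube_measure [simp]: "space (cube_measure n) = UNIV"
  using sets_eq_imp_space_eq[OF sets_cube_measure] by simp

lemma prob_space_cube_measure: "prob_space (cube_measure n)"
proof (induction n)
  case 0
  then show ?case by (auto intro: prob_space_return)
next
  case (Suc n)
  interpret A: prob_space "cube_measure n" by fact
  interpret B: prob_space unif by (rule prob_space_unif)
  interpret pair_prob_space "cube_measure n" unif ..
  show ?case unfolding cube_measure.simps by (intro prob_space_distr) measurable
qed

lemma integrable_cube_measure_bounded:
  fixes f :: "(nat \<Rightarrow> real) \<Rightarrow> real"
  assumes "f \<in> borel_measurable borel" "\<And>x. \<bar>f x\<bar> \<le> B"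
  shows "integrable (cube_measure n) f"
proof -
  interpret prob_space "cube_measure n" by (rule prob_space_cube_measure)
  show ?thesis
    using assms by (intro integrable_const_bound[where B=B]) (auto simp: measurable_cong_sets[OF sets_cube_measure refl])
qed

lemma integral_cube_measure_Suc:
  fixes f :: "(nat \<Rightarrow> real) \<Rightarrow> real"
  assumes [measurable]: "f \<in> borel_measurable borel" and f: "\<And>x. \<bar>f x\<bar> \<le> B"
  shows "(\<integral>x. f x \<partial>cube_measure (Suc n)) = (\<integral>x. (\<integral>t. f (x(n := t)) \<partial>unif) \<partial>cube_measure n)"
    and "(\<lambda>x. \<integral>t. f (x(n := t)) \<partial>unif) \<in> borel_measurable borel"
proof -
  interpret A: prob_space "cube_measure n" by (rule prob_space_cube_measure)
  interpret B: prob_space unif by (rule prob_space_unif)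
  interpret pair_prob_space "cube_measure n" unif ..
  have [measurable]: "(\<lambda>(x, t). f (x(n := t))) \<in> borel_measurable (borel \<Otimes>\<^sub>M borel)"
    using measurable_compose[OF measurable_fun_upd_borel[of n] assms(1)] by (simp add: case_prod_beta)
  then have m: "(\<lambda>(x, t). f (x(n := t))) \<in> borel_measurable (cube_measure n \<Otimes>\<^sub>M unif)"
    by (simp cong: measurable_cong_sets sets_pair_measure_cong)
  have i: "integrable (cube_measure n \<Otimes>\<^sub>M unif) (\<lambda>(x, t). f (x(n := t)))"
    using f m by (intro P.integrable_const_bound[where B=B]) (auto intro!: AE_I2)
  have "(\<integral>x. f x \<partial>cube_measure (Suc n)) = (\<integral>z. f ((\<lambda>(x, t). x(n := t)) z) \<partial>(cube_measure n \<Otimes>\<^sub>M unif))"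
    unfolding cube_measure.simps by (intro integral_distr) measurable
  also have "\<dots> = (\<integral>z. (\<lambda>(x, t). f (x(n := t))) z \<partial>(cube_measure n \<Otimes>\<^sub>M unif))"
    by (simp add: case_prod_beta)
  also have "\<dots> = (\<integral>x. (\<integral>t. f (x(n := t)) \<partial>unif) \<partial>cube_measure n)"
    using integral_fst'[OF i] by simp
  finally show "(\<integral>x. f x \<partial>cube_measure (Suc n)) = (\<integral>x. (\<integral>t. f (x(n := t)) \<partial>unif) \<partial>cube_measure n)" .
  show "(\<lambda>x. \<integral>t. f (x(n := t)) \<partial>unif) \<in> borel_measurable borel"
    by measurable
qed

text \<open>Tensorization: after the last coordinate is integrated out, the one-dimensional
  inequality on the fibres is exactly the hypothesis for the three fibre integrals. In dimension 0
  the measure is a point mass at the origin.\<close>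

lemma prekopa_leindler_cube:
  fixes f g h :: "(nat \<Rightarrow> real) \<Rightarrow> real"
  assumes "f \<in> borel_measurable borel" "g \<in> borel_measurable borel" "h \<in> borel_measurable borel"
    and "\<And>x. f x \<in> {0..1}" "\<And>x. g x \<in> {0..1}" "\<And>x. h x \<in> {0..1}"
    and l: "0 < l" "l < 1"
    and "\<And>x y. f x powr l * g y powr (1 - l) \<le> h (\<lambda>i. l * x i + (1 - l) * y i)"
  shows "(\<integral>x. f x \<partial>cube_measure n) powr l * (\<integral>x. g x \<partial>cube_measure n) powr (1 - l)
       \<le> (\<integral>x. h x \<partial>cube_measure n)"
  using assms(1-6,9)
proof (induction n arbitrary: f g h)
  case 0
  have "(\<integral>x. u x \<partial>cube_measure 0) = u (\<lambda>_. 0)" if "u \<in> borel_measurable borel" for u :: "(nat \<Rightarrow> real) \<Rightarrow> real"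
    unfolding cube_measure.simps using that by (intro integral_return) auto
  then show ?case using 0(7)[of "\<lambda>_. 0" "\<lambda>_. 0"] 0(1-3) by simp
next
  case (Suc n)
  interpret B: prob_space unif by (rule prob_space_unif)
  have sec: "(\<lambda>t. u (x(n := t))) \<in> borel_measurable borel" if [measurable]: "u \<in> borel_measurable borel" for u :: "(nat \<Rightarrow> real) \<Rightarrow> real" and x
  proof -
    have "(\<lambda>t. (x, t)) \<in> borel \<rightarrow>\<^sub>M (borel \<Otimes>\<^sub>M borel)" by measurable
    from measurable_compose[OF measurable_compose[OF this measurable_fun_upd_borel[of n]] that]
    show ?thesis by simp
  qed
  have val: "(\<integral>t. u (x(n := t)) \<partial>unif) \<in> {0..1}"
    if "u \<in> borel_measurable borel" "\<And>x. u x \<in> {0..1}" for u :: "(nat \<Rightarrow> real) \<Rightarrow> real" and x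
  proof -
    have "integrable unif (\<lambda>t. u (x(n := t)))"
      using that sec[OF that(1)]
      by (intro B.integrable_const_bound[where B=1]) (auto simp: measurable_cong_sets[OF sets_unif refl])
    then show ?thesis using that(2)
      by (auto intro!: integral_nonneg_AE B.integral_le_const)
  qed
  have ab: "\<bar>u x\<bar> \<le> 1" if "\<And>x. u x \<in> {0..1}" for u :: "(nat \<Rightarrow> real) \<Rightarrow> real" and x
    using that[of x] by auto
  note I = integral_cube_measure_Suc[where B=1 and n=n]
  have "(\<integral>x. (\<integral>t. f (x(n := t)) \<partial>unif) \<partial>cube_measure n) powr l * (\<integral>x. (\<integral>t. g (x(n := t)) \<partial>unif) \<partial>cube_measure n) powr (1 - l)
    \<le> (\<integral>x. (\<integral>t. h (x(n := t)) \<partial>unif) \<partial>cube_measure n)"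
  proof (rule Suc.IH)
    show "(\<lambda>x. \<integral>t. f (x(n := t)) \<partial>unif) \<in> borel_measurable borel"
      "(\<lambda>x. \<integral>t. g (x(n := t)) \<partial>unif) \<in> borel_measurable borel"
      "(\<lambda>x. \<integral>t. h (x(n := t)) \<partial>unif) \<in> borel_measurable borel"
      by (intro I(2) ab Suc.prems)+
    show "(\<integral>t. f (x(n := t)) \<partial>unif) \<in> {0..1}" "(\<integral>t. g (x(n := t)) \<partial>unif) \<in> {0..1}"
      "(\<integral>t. h (x(n := t)) \<partial>unif) \<in> {0..1}" for x
      by (intro val Suc.prems)+
    fix x y
    show "(\<integral>t. f (x(n := t)) \<partial>unif) powr l * (\<integral>t. g (y(n := t)) \<partial>unif) powr (1 - l)
        \<le> (\<integral>t. h ((\<lambda>i. l * x i + (1 - l) * y i)(n := t)) \<partial>unif)"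
    proof (rule prekopa_leindler_unif[OF _ _ _ _ _ _ l])
      fix s t
      have "(\<lambda>i. l * (x(n := s)) i + (1 - l) * (y(n := t)) i) = (\<lambda>i. l * x i + (1 - l) * y i)(n := l * s + (1 - l) * t)"
        by auto
      from Suc.prems(7)[of "x(n := s)" "y(n := t)", unfolded this]
      show "f (x(n := s)) powr l * g (y(n := t)) powr (1 - l)
          \<le> h ((\<lambda>i. l * x i + (1 - l) * y i)(n := l * s + (1 - l) * t))" .
    qed (use Suc.prems sec in auto)
  qed
  then show ?case using I(1)[of f] I(1)[of g] I(1)[of h] Suc.prems ab by simp
qed

section \<open>Log-concavity and barycenter of the cube measure\<close>

lemma borel_measurable_coordinate [measurable]:
  "(\<lambda>x :: nat \<Rightarrow> real. x i) \<in> borel_measurable borel"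
  by (intro borel_measurable_continuous_onI continuous_on_product_coordinates)

lemma closed_Rn: "closed (Rn n)"
proof -
  have "Rn n = (\<Inter>i\<in>{n..}. {x. x i = 0})" by (auto simp: Rn_def)
  also have "closed \<dots>"
    by (intro closed_INT ballI closed_Collect_eq continuous_on_product_coordinates continuous_on_const)
  finally show ?thesis .
qed

lemma sets_Rn [measurable]: "Rn n \<in> sets borel"
  by (intro borel_closed closed_Rn)

text \<open>Compactness makes the combination a Borel set, so that its measure is not the default
  value 0 of a nonmeasurable set.\<close>

lemma compact_minkowski_comb:
  assumes "compact A" "compact B"
  shows "compact (minkowski_comb l A B)"
proof -
  have c: "continuous_on UNIV (\<lambda>z :: (nat \<Rightarrow> real) \<times> (nat \<Rightarrow> real). (\<lambda>i. l * fst z i + (1 - l) * snd z i))"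
    by (intro continuous_on_coordinatewise_then_product continuous_intros
        continuous_on_product_then_coordinatewise[OF continuous_on_fst]
        continuous_on_product_then_coordinatewise[OF continuous_on_snd])
  have "minkowski_comb l A B = (\<lambda>z. (\<lambda>i. l * fst z i + (1 - l) * snd z i)) ` (A \<times> B)"
    by (force simp: minkowski_comb_def)
  then show ?thesis
    using assms by (auto intro!: compact_continuous_image compact_Times continuous_on_subset[OF c])
qed

lemma sets_hyperplane_Rn: "hyperplane_Rn n a c \<in> sets borel"
proof -
  have "hyperplane_Rn n a c = {x \<in> space borel. x \<in> Rn n \<and> (\<Sum>i<n. a i * x i) = c}"
    by (simp add: hyperplane_Rn_def)
  also have "\<dots> \<in> sets borel" by measurable
  finally show ?thesis .
qed

lemma measure_cube_measure_Suc:
  assumes [measurable]: "A \<in> sets borel"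
  shows "measure (cube_measure (Suc n)) A = (\<integral>x. measure unif {t. x(n := t) \<in> A} \<partial>cube_measure n)"
proof -
  interpret B: prob_space unif by (rule prob_space_unif)
  have "measure (cube_measure (Suc n)) A = (\<integral>x. indicator A x \<partial>cube_measure (Suc n))"
    by simp
  also have "\<dots> = (\<integral>x. (\<integral>t. indicator A (x(n := t)) \<partial>unif) \<partial>cube_measure n)"
    by (rule integral_cube_measure_Suc[where B=1]) (auto split: split_indicator)
  also have "\<dots> = (\<integral>x. measure unif {t. x(n := t) \<in> A} \<partial>cube_measure n)"
  proof -
    have "(\<lambda>t. indicator A (x(n := t)) :: real) = indicator {t. x(n := t) \<in> A}" for x
      by (auto simp: indicator_def)
    then show ?thesis by simp
  qed
  finally show ?thesis .
qed

lemma AE_cube_measure_Suc: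
  assumes P: "{x. P x} \<in> sets borel"
    and ae: "AE x in cube_measure n. AE t in unif. P (x(n := t))"
  shows "AE x in cube_measure (Suc n). P x"
proof -
  interpret A: prob_space "cube_measure n" by (rule prob_space_cube_measure)
  interpret B: prob_space unif by (rule prob_space_unif)
  interpret pair_prob_space "cube_measure n" unif ..
  have m: "(\<lambda>(x, t). x(n := t)) \<in> (cube_measure n \<Otimes>\<^sub>M unif) \<rightarrow>\<^sub>M borel"
    by measurable
  have "{z \<in> space (cube_measure n \<Otimes>\<^sub>M unif). P ((\<lambda>(x, t). x(n := t)) z)} \<in> sets (cube_measure n \<Otimes>\<^sub>M unif)"
    using measurable_sets[OF m P] by (simp add: vimage_def Int_def conj_commute)
  then have "AE z in cube_measure n \<Otimes>\<^sub>M unif. P ((\<lambda>(x, t). x(n := t)) z)"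
    using ae by (intro AE_pair_measure) auto
  then show ?thesis unfolding cube_measure.simps using m P by (subst AE_distr_iff) auto
qed

lemma measure_cube_measure_Rn: "measure (cube_measure n) (Rn n) = 1"
proof (induction n)
  case 0
  have "(\<lambda>_. 0) \<in> Rn 0" by (simp add: Rn_def)
  then show ?case by (simp add: measure_return)
next
  case (Suc n)
  interpret A: prob_space "cube_measure n" by (rule prob_space_cube_measure)
  interpret C: prob_space "cube_measure (Suc n)" by (rule prob_space_cube_measure)
  have "AE x in cube_measure n. x \<in> Rn n"
    using Suc.IH by (subst A.AE_in_set_eq_1) auto
  then have "AE x in cube_measure n. AE t in unif. x(n := t) \<in> Rn (Suc n)"
    by (auto elim!: AE_mp simp: Rn_def)
  then have "AE x in cube_measure (Suc n). x \<in> Rn (Suc n)"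
    by (intro AE_cube_measure_Suc) auto
  then show ?case by (subst (asm) C.AE_in_set_eq_1) auto
qed

text \<open>If the last coefficient is nonzero, every fibre has at most one point and is null.
  Otherwise the equation does not involve the last coordinate, and the claim is the one in the lower
  dimension.\<close>

lemma measure_cube_measure_hyperplane:
  assumes "\<exists>i<n. a i \<noteq> 0"
  shows "measure (cube_measure n) (hyperplane_Rn n a c) < 1"
  using assms
proof (induction n)
  case 0
  then show ?case by simp
next
  case (Suc n)
  interpret A: prob_space "cube_measure n" by (rule prob_space_cube_measure)
  interpret B: prob_space unif by (rule prob_space_unif)
  have s: "(\<Sum>i<Suc n. a i * (x(n := t)) i) = (\<Sum>i<n. a i * x i) + a n * t" for x t
    by simp
  have s': "(\<Sum>i<n. a i * (x(n := t)) i) = (\<Sum>i<n. a i * x i)" for x t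
    by simp
  have [measurable]: "{x. (\<Sum>i<n. a i * x i) = c} \<in> sets borel"
  proof -
    have "{x \<in> space borel. (\<Sum>i<n. a i * x i) = c} \<in> sets borel" by measurable
    then show ?thesis by simp
  qed
  show ?case
  proof (cases "a n = 0")
    case False
    have "measure unif {t. x(n := t) \<in> hyperplane_Rn (Suc n) a c} = 0" for x
    proof -
      have "measure unif {t. x(n := t) \<in> hyperplane_Rn (Suc n) a c} \<le> measure unif {(c - (\<Sum>i<n. a i * x i)) / a n}"
        using False by (intro B.finite_measure_mono) (auto simp: hyperplane_Rn_def s field_simps)
      also have "\<dots> = 0"
      proof -
        have "measure lebesgue ({(c - (\<Sum>i<n. a i * x i)) / a n} \<inter> {-1..1}) = 0"
          by (intro negligible_imp_measure0 negligible_finite) auto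
        then show ?thesis by (subst measure_unif) auto
      qed
      finally show ?thesis by (simp add: measure_le_0_iff)
    qed
    then show ?thesis
      by (simp add: measure_cube_measure_Suc sets_hyperplane_Rn del: cube_measure.simps)
  next
    case True
    then have "\<exists>i<n. a i \<noteq> 0" using Suc.prems less_Suc_eq by auto
    then have IH: "measure (cube_measure n) (hyperplane_Rn n a c) < 1" by (rule Suc.IH)
    have "measure (cube_measure (Suc n)) (hyperplane_Rn (Suc n) a c)
        = (\<integral>x. measure unif {t. x(n := t) \<in> hyperplane_Rn (Suc n) a c} \<partial>cube_measure n)"
      by (rule measure_cube_measure_Suc[OF sets_hyperplane_Rn])
    also have "\<dots> \<le> (\<integral>x. indicator {x. (\<Sum>i<n. a i * x i) = c} x \<partial>cube_measure n)"
    proof (rule integral_mono_AE')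
      show "AE x in cube_measure n. measure unif {t. x(n := t) \<in> hyperplane_Rn (Suc n) a c}
          \<le> indicator {x. (\<Sum>i<n. a i * x i) = c} x"
        using True B.prob_le_1 by (auto simp: hyperplane_Rn_def s s' split: split_indicator simp del: fun_upd_apply)
    qed (auto intro!: integrable_cube_measure_bounded[where B=1] split: split_indicator)
    also have "\<dots> = measure (cube_measure n) {x. (\<Sum>i<n. a i * x i) = c}" by simp
    also have "\<dots> = measure (cube_measure n) (hyperplane_Rn n a c)"
    proof (rule A.finite_measure_eq_AE)
      have "AE x in cube_measure n. x \<in> Rn n"
        using measure_cube_measure_Rn by (subst A.AE_in_set_eq_1) auto
      then show "AE x in cube_measure n. x \<in> {x. (\<Sum>i<n. a i * x i) = c} \<longleftrightarrow> x \<in> hyperplane_Rn n a c"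
        by (auto elim!: AE_mp simp: hyperplane_Rn_def)
    qed (auto simp: sets_hyperplane_Rn)
    finally show ?thesis using IH by simp
  qed
qed

text \<open>This is Prekopa--Leindler for three indicators; their pointwise hypothesis holds because
  \<open>0 powr l = 0\<close>.\<close>

lemma log_concave_prob_cube: "log_concave_prob n (cube_measure n)"
  unfolding log_concave_prob_def
proof (intro conjI allI impI)
  fix A B and l :: real
  assume *: "compact A \<and> compact B \<and> A \<subseteq> Rn n \<and> B \<subseteq> Rn n \<and> 0 < l \<and> l < 1"
  have [measurable]: "A \<in> sets borel" "B \<in> sets borel" "minkowski_comb l A B \<in> sets borel"
    using * by (auto intro!: borel_compact compact_minkowski_comb)
  have "(\<integral>x. indicator A x \<partial>cube_measure n) powr l * (\<integral>x. indicator B x \<partial>cube_measure n) powr (1 - l)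
      \<le> (\<integral>x. indicator (minkowski_comb l A B) x \<partial>cube_measure n)"
  proof (rule prekopa_leindler_cube)
    fix x y
    have "(\<lambda>i. l * x i + (1 - l) * y i) \<in> minkowski_comb l A B" if "x \<in> A" "y \<in> B"
      using that by (auto simp: minkowski_comb_def)
    then show "indicator A x powr l * indicator B y powr (1 - l) \<le> (indicator (minkowski_comb l A B) (\<lambda>i. l * x i + (1 - l) * y i) :: real)"
      using * by (auto split: split_indicator)
  qed (use * in \<open>auto split: split_indicator\<close>)
  then show "measure (cube_measure n) A powr l * measure (cube_measure n) B powr (1 - l)
      \<le> measure (cube_measure n) (minkowski_comb l A B)" by simp
qed (auto simp: prob_space_cube_measure measure_cube_measure_Rn measure_cube_measure_hyperplane)

lemma AE_cube_measure_coordinate: "AE x in cube_measure n. \<bar>x i\<bar> \<le> 1"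
proof (induction n)
  case 0
  show ?case unfolding cube_measure.simps by (subst AE_return) auto
next
  case (Suc n)
  have "AE x in cube_measure n. AE t in unif. \<bar>(x(n := t)) i\<bar> \<le> 1"
  proof (cases "i = n")
    case True
    have "AE t in unif. \<bar>t\<bar> \<le> 1" using AE_unif by (auto elim!: AE_mp)
    then show ?thesis using True by simp
  next
    case False
    then show ?thesis using Suc.IH by (auto elim!: AE_mp)
  qed
  moreover have "{x :: nat \<Rightarrow> real. \<bar>x i\<bar> \<le> 1} \<in> sets borel"
  proof -
    have "{x \<in> space borel. \<bar>(x :: nat \<Rightarrow> real) i\<bar> \<le> 1} \<in> sets borel" by measurable
    then show ?thesis by simp
  qed
  ultimately show ?case by (intro AE_cube_measure_Suc)
qed

lemma barycenter_origin_cube: "barycenter_origin n (cube_measure n)"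
proof -
  \<comment> \<open>The coordinates are bounded only almost everywhere, while the Fubini formula
    asks for a bound everywhere. The function \<open>clip\<close> equals the identity on the support
    and is odd, hence has mean 0.\<close>
  define clip :: "real \<Rightarrow> real" where "clip t = max (-1) (min 1 t)" for t
  have clip: "\<bar>clip t\<bar> \<le> 1" for t by (auto simp: clip_def)
  have [measurable]: "clip \<in> borel_measurable borel" unfolding clip_def by measurable
  have ae: "AE x in cube_measure n. x i = clip (x i)" for i n
    using AE_cube_measure_coordinate[of i n] by (auto elim!: AE_mp simp: clip_def)
  have z: "(\<integral>t. clip t \<partial>unif) = 0"
  proof -
    have "(\<integral>t. clip t \<partial>unif) = (\<integral>t. indicator {-1..1} t *\<^sub>R clip t \<partial>lborel) / 2"
    proof -
      have d: "unif = density lborel (\<lambda>t. ennreal (indicator {-1..1} t / 2))"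
        unfolding unif_def uniform_measure_def
        by (intro density_cong) (auto split: split_indicator simp: divide_ennreal[symmetric])
      have "(\<integral>t. clip t \<partial>unif) = (\<integral>t. (indicator {-1..1} t / 2) *\<^sub>R clip t \<partial>lborel)"
        unfolding d by (intro integral_density) auto
      also have "\<dots> = (\<integral>t. indicator {-1..1} t *\<^sub>R clip t / 2 \<partial>lborel)"
        by (intro Bochner_Integration.integral_cong) auto
      finally show ?thesis by simp
    qed
    also have "(\<integral>t. indicator {-1..1} t *\<^sub>R clip t \<partial>lborel) = 0"
    proof -
      have "(\<integral>t. indicator {-1..1} t *\<^sub>R clip t \<partial>lborel) = (\<integral>t. indicator {-1..1} (- t) *\<^sub>R clip (- t) \<partial>lborel)"
        using lborel_integral_real_affine[of "-1" "\<lambda>t. indicator {-1..1} t *\<^sub>R clip t" 0] by simp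
      also have "\<dots> = (\<integral>t. - (indicator {-1..1} t *\<^sub>R clip t) \<partial>lborel)"
        by (intro Bochner_Integration.integral_cong) (auto simp: clip_def split: split_indicator)
      finally show ?thesis by simp
    qed
    finally show ?thesis by simp
  qed
  have "(\<integral>x. clip (x i) \<partial>cube_measure n) = 0" if "i < n" for i n
    using that
  proof (induction n)
    case (Suc n)
    interpret B: prob_space unif by (rule prob_space_unif)
    have "(\<integral>x. clip (x i) \<partial>cube_measure (Suc n)) = (\<integral>x. (\<integral>t. clip ((x(n := t)) i) \<partial>unif) \<partial>cube_measure n)"
      by (rule integral_cube_measure_Suc[where B=1]) (auto simp: clip)
    then show ?case using Suc z by (cases "i = n") (auto simp: B.prob_space)
  qed simp
  moreover have "(\<integral>x. x i \<partial>cube_measure n) = (\<integral>x. clip (x i) \<partial>cube_measure n)" for i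
    using ae by (intro integral_cong_AE) auto
  moreover have "integrable (cube_measure n) (\<lambda>x. x i)" for i
  proof -
    interpret A: prob_space "cube_measure n" by (rule prob_space_cube_measure)
    show ?thesis
      using AE_cube_measure_coordinate by (intro A.integrable_const_bound[where B=1]) auto
  qed
  ultimately show ?thesis by (simp add: barycenter_origin_def)
qed

subsection \<open>Moments of linear functionals\<close>

definition lin :: "nat \<Rightarrow> (nat \<Rightarrow> real) \<Rightarrow> (nat \<Rightarrow> real) \<Rightarrow> real" where
  "lin n a x = (\<Sum>i<n. a i * x i)"

lemma lin_scale: "lin n (\<lambda>i. c * a i) x = c * lin n a x"
  by (simp add: lin_def sum_distrib_left mult.assoc)

lemma lin_comb:
  "lin n a (\<lambda>i. l * x i + k * y i) = l * lin n a x + k * lin n a y"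
  by (simp add: lin_def sum_distrib_left sum.distrib algebra_simps)

lemma continuous_on_lin: "continuous_on UNIV (lin n a)"
  unfolding lin_def by (intro continuous_intros continuous_on_product_coordinates)

lemma borel_measurable_lin [measurable]: "lin n a \<in> borel_measurable borel"
  by (intro borel_measurable_continuous_onI continuous_on_lin)

text \<open>Tychonoff, with factor \<open>{0}\<close> from index \<open>n\<close> on. These boxes
  cut closed sets down to the compact sets for which log-concavity is assumed.\<close>

lemma compact_box_Rn: "compact {x \<in> Rn n. \<forall>i<n. \<bar>x i\<bar> \<le> M}"
proof -
  have "{x \<in> Rn n. \<forall>i<n. \<bar>x i\<bar> \<le> M} = PiE UNIV (\<lambda>i. if i < n then {-M..M} else {0})"
    by (auto simp: Rn_def PiE_def Pi_iff abs_le_iff minus_le_iff split: if_splits)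
  moreover have "compactin (product_topology (\<lambda>_. euclidean) UNIV) (PiE UNIV (\<lambda>i. if i < n then {-M..M} else {0::real}))"
    unfolding compactin_PiE by auto
  ultimately show ?thesis
    by (simp add: euclidean_product_topology)
qed

section \<open>Tails and moments under a log-concave measure\<close>

locale log_concave =
  fixes n :: nat and \<mu> :: "(nat \<Rightarrow> real) measure"
  assumes lc: "log_concave_prob n \<mu>"
begin

sublocale prob_space \<mu>
  using lc by (simp add: log_concave_prob_def)

lemma sets_mu [simp, measurable_cong]: "sets \<mu> = sets borel"
  using lc by (simp add: log_concave_prob_def)

lemma space_mu [simp]: "space \<mu> = UNIV"
  using sets_eq_imp_space_eq[OF sets_mu] by simp

lemma prob_UNIV [simp]: "prob UNIV = 1"
  using prob_space by simp

lemma sets_Collect_mu: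
  assumes "Measurable.pred borel P"
  shows "{x. P x} \<in> sets \<mu>"
  using assms by (simp add: pred_def)

lemma AE_Rn: "AE x in \<mu>. x \<in> Rn n"
  using lc by (subst AE_in_set_eq_1) (auto simp: log_concave_prob_def)

lemma prob_Int_Rn:
  assumes [measurable]: "A \<in> sets borel"
  shows "prob (A \<inter> Rn n) = prob A"
  using AE_Rn by (intro finite_measure_eq_AE) (auto elim!: AE_mp)

text \<open>Log-concavity speaks of compact sets, while half-spaces and slabs are unbounded;
  exhaustion by boxes transfers the inequality to them in the limit.\<close>

lemma measure_box_tendsto:
  assumes cl: "closed F"
  shows "(\<lambda>M. prob (F \<inter> {x \<in> Rn n. \<forall>i<n. \<bar>x i\<bar> \<le> real M})) \<longlonglongrightarrow> prob F"
proof -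
  let ?A = "\<lambda>M. F \<inter> {x \<in> Rn n. \<forall>i<n. \<bar>x i\<bar> \<le> real M}"
  have F: "F \<in> sets borel" using cl by auto
  have "(\<lambda>M. prob (?A M)) \<longlonglongrightarrow> prob (\<Union>M. ?A M)"
  proof (rule finite_Lim_measure_incseq)
    have "?A M \<in> sets borel" for M
      using F borel_compact[OF compact_box_Rn[of n "real M"]] by (rule sets.Int)
    then show "range ?A \<subseteq> events" by auto
    show "incseq ?A" by (force simp: incseq_def)
  qed
  also have "(\<Union>M. ?A M) = F \<inter> Rn n"
  proof (intro equalityI subsetI)
    fix x assume x: "x \<in> F \<inter> Rn n"
    obtain M where "(\<Sum>i<n. \<bar>x i\<bar>) \<le> real M" using real_arch_simple by blast
    moreover have "\<bar>x i\<bar> \<le> (\<Sum>i<n. \<bar>x i\<bar>)" if "i < n" for i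
      using that by (intro member_le_sum) auto
    ultimately have "x \<in> ?A M" using x by force
    then show "x \<in> (\<Union>M. ?A M)" by blast
  qed auto
  finally show ?thesis using F by (simp add: prob_Int_Rn)
qed

text \<open>Borell's lemma: a point beyond \<open>t\<close> and a point of the central slab average to a point
  beyond 3, and that half-space has measure at most 1/3 by Markov's inequality.\<close>

lemma half_space_tail:
  assumes int: "integrable \<mu> (lin n a)" and E: "(\<integral>x. \<bar>lin n a x\<bar> \<partial>\<mu>) \<le> 1" and t: "3 < t"
  shows "prob {x. t \<le> lin n a x} \<le> (1 / 2) powr ((t + 3) / 6)"
proof -
  \<comment> \<open>The solution of \<open>l * t + (1 - l) * (-3) = 3\<close>, the worst case being
    a point at \<open>t\<close> averaged with a slab point at \<open>-3\<close>. It is below 1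
    because \<open>t > 3\<close>.\<close>
  define l where "l = 6 / (t + 3)"
  have l: "0 < l" "l < 1" using t by (auto simp: l_def)
  let ?box = "\<lambda>M. {x \<in> Rn n. \<forall>i<n. \<bar>x i\<bar> \<le> real M}"
  let ?A = "{x. \<bar>lin n a x\<bar> \<le> 3}" and ?B = "{x. t \<le> lin n a x}"
  have clA: "closed ?A"
    by (intro closed_Collect_le continuous_on_const continuous_on_rabs continuous_on_lin)
  have clB: "closed ?B"
    by (intro closed_Collect_le continuous_on_const continuous_on_lin)
  have markov: "prob {x. 3 \<le> \<bar>lin n a x\<bar>} \<le> 1 / 3"
  proof -
    have "prob {x \<in> space \<mu>. 3 \<le> \<bar>lin n a x\<bar>} \<le> (\<integral>x. \<bar>lin n a x\<bar> \<partial>\<mu>) / 3"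
      using int by (intro integral_Markov_inequality_measure[where A="{}"]) auto
    then show ?thesis using E by simp
  qed
  have A: "2 / 3 \<le> prob ?A"
  proof -
    have "prob (space \<mu> - ?A) \<le> prob {x. 3 \<le> \<bar>lin n a x\<bar>}"
      by (intro finite_measure_mono) (auto intro!: sets_Collect_mu)
    moreover have "prob (space \<mu> - ?A) = 1 - prob ?A"
      by (intro prob_compl) (auto intro!: sets_Collect_mu)
    ultimately show ?thesis using markov by linarith
  qed
  have lim: "(\<lambda>M. prob (?B \<inter> ?box M) powr l * prob (?A \<inter> ?box M) powr (1 - l))
      \<longlonglongrightarrow> prob ?B powr l * prob ?A powr (1 - l)"
    using l by (intro tendsto_mult tendsto_powr' measure_box_tendsto clA clB tendsto_const) auto
  have "prob ?B powr l * prob ?A powr (1 - l) \<le> 1 / 3"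
  proof (rule LIMSEQ_le_const2[OF lim], intro exI allI impI)
    fix M :: nat
    have c: "compact (?A \<inter> ?box M)" "compact (?B \<inter> ?box M)"
      using clA clB compact_box_Rn by (auto intro!: closed_Int_compact)
    have "prob (?B \<inter> ?box M) powr l * prob (?A \<inter> ?box M) powr (1 - l)
        \<le> prob (minkowski_comb l (?B \<inter> ?box M) (?A \<inter> ?box M))"
    proof -
      have "\<forall>A B l. compact A \<and> compact B \<and> A \<subseteq> Rn n \<and> B \<subseteq> Rn n \<and> 0 < l \<and> l < 1 \<longrightarrow>
        prob A powr l * prob B powr (1 - l) \<le> prob (minkowski_comb l A B)"
        using lc unfolding log_concave_prob_def by blast
      moreover have "?A \<inter> ?box M \<subseteq> Rn n" "?B \<inter> ?box M \<subseteq> Rn n" by auto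
      ultimately show ?thesis using c l by blast
    qed
    also have "\<dots> \<le> prob {x. 3 \<le> \<bar>lin n a x\<bar>}"
    proof (rule finite_measure_mono)
      show "minkowski_comb l (?B \<inter> ?box M) (?A \<inter> ?box M) \<subseteq> {x. 3 \<le> \<bar>lin n a x\<bar>}"
      proof
        fix z assume "z \<in> minkowski_comb l (?B \<inter> ?box M) (?A \<inter> ?box M)"
        then obtain x y where z: "z = (\<lambda>i. l * x i + (1 - l) * y i)" and xy: "t \<le> lin n a x" "\<bar>lin n a y\<bar> \<le> 3"
          by (auto simp: minkowski_comb_def)
        have "l * (t + 3) = 6" using t by (simp add: l_def divide_eq_eq)
        then have "3 = l * t + (1 - l) * (-3)" by (simp add: algebra_simps)
        also have "\<dots> \<le> l * lin n a x + (1 - l) * lin n a y"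
          using xy l by (intro add_mono mult_left_mono) auto
        also have "\<dots> = lin n a z" by (simp add: z lin_comb)
        finally show "z \<in> {x. 3 \<le> \<bar>lin n a x\<bar>}" by auto
      qed
    qed (auto intro!: sets_Collect_mu)
    also note markov
    finally show "prob (?B \<inter> ?box M) powr l * prob (?A \<inter> ?box M) powr (1 - l) \<le> 1 / 3" .
  qed
  \<comment> \<open>An exponent in (0,1) only increases \<open>2 / 3\<close>, so the slab factor is
    at least \<open>2 / 3\<close>, and \<open>prob ?B powr l\<close> is at most
    \<open>(1 / 3) / (2 / 3)\<close>.\<close>
  moreover have "prob ?B powr l * (2 / 3) \<le> prob ?B powr l * prob ?A powr (1 - l)"
  proof (rule mult_left_mono)
    have "2 / 3 = (2 / 3 :: real) powr 1" by simp
    also have "\<dots> \<le> (2 / 3) powr (1 - l)" using l by (intro powr_mono') auto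
    also have "\<dots> \<le> prob ?A powr (1 - l)" using A l by (intro powr_mono2) auto
    finally show "2 / 3 \<le> prob ?A powr (1 - l)" .
  qed auto
  ultimately have "prob ?B powr l \<le> 1 / 2" by simp
  then have "(prob ?B powr l) powr (1 / l) \<le> (1 / 2) powr (1 / l)"
    using l by (intro powr_mono2) auto
  moreover have "(prob ?B powr l) powr (1 / l) = prob ?B"
    using l by (simp add: powr_powr)
  moreover have "1 / l = (t + 3) / 6" by (simp add: l_def)
  ultimately show ?thesis by simp
qed

end

text \<open>Term \<open>k\<close> bounds the second-moment contribution of the shell between
  \<open>6 * k\<close> and \<open>6 * (k + 1)\<close>: the square is at most
  \<open>36 * (k + 1)^2\<close> and the two-sided tail at most
  \<open>2 * (1 / 2) ^ k\<close>.\<close>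

definition borell_const :: real where
  "borell_const = (\<Sum>k. 72 * (real k + 1)\<^sup>2 * (1 / 2) ^ k)"

lemma summable_borell_const: "summable (\<lambda>k. 72 * (real k + 1)\<^sup>2 * (1 / 2) ^ k)"
proof (rule summable_ratio_test[where c="3/4" and N=5])
  fix k :: nat assume k: "5 \<le> k"
  have "2 * (real k + 2)\<^sup>2 \<le> 3 * (real k + 1)\<^sup>2"
  proof -
    \<comment> \<open>The difference of the two sides is
      \<open>k^2 - 2 * k - 5 = (k - 5) * (k + 3) + 10\<close>.\<close>
    have "0 \<le> (real k - 5) * (real k + 3)" using k by simp
    then show ?thesis by (simp add: power2_eq_square algebra_simps)
  qed
  then have "2 * (real k + 2)\<^sup>2 * (1 / 2) ^ k \<le> 3 * (real k + 1)\<^sup>2 * (1 / 2) ^ k"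
    by (intro mult_right_mono) auto
  then show "norm (72 * (real (Suc k) + 1)\<^sup>2 * (1 / 2) ^ Suc k) \<le> 3 / 4 * norm (72 * (real k + 1)\<^sup>2 * (1 / 2) ^ k)"
    by (simp add: algebra_simps abs_mult)
qed simp

lemma borell_const_pos: "0 < borell_const"
  unfolding borell_const_def by (intro suminf_pos summable_borell_const) auto

context log_concave
begin

text \<open>Each value is dominated by the summand of its own shell, and exponential tails make the
  sum converge. The integral is a nonnegative one because integrability of the square is a
  consequence of this bound.\<close>

lemma second_moment_normalized:
  assumes int: "integrable \<mu> (lin n a)" and E: "(\<integral>x. \<bar>lin n a x\<bar> \<partial>\<mu>) \<le> 1"
  shows "(\<integral>\<^sup>+x. ennreal ((lin n a x)\<^sup>2) \<partial>\<mu>) \<le> ennreal borell_const"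
proof -
  \<comment> \<open>The case \<open>k = 0\<close> is trivial. For larger \<open>k\<close> the
    threshold \<open>6 * k\<close> exceeds 3, and the half-space bound applies to both
    \<open>a\<close> and \<open>- a\<close>.\<close>
  have tail: "prob {x. 6 * real k \<le> \<bar>lin n a x\<bar>} \<le> 2 * (1 / 2) ^ k" for k
  proof (cases "k = 0")
    case True
    have "prob {x. 6 * real k \<le> \<bar>lin n a x\<bar>} \<le> 2" by (rule order_trans[OF prob_le_1]) simp
    then show ?thesis using True by simp
  next
    case False
    have one: "prob {x. 6 * real k \<le> lin n b x} \<le> (1 / 2) ^ k"
      if "integrable \<mu> (lin n b)" "(\<integral>x. \<bar>lin n b x\<bar> \<partial>\<mu>) \<le> 1" for b
    proof -
      have "prob {x. 6 * real k \<le> lin n b x} \<le> (1 / 2) powr ((6 * real k + 3) / 6)"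
        using False that by (intro half_space_tail) auto
      also have "\<dots> \<le> (1 / 2) powr real k"
        by (intro powr_mono') auto
      finally show ?thesis by (simp add: powr_realpow)
    qed
    have m: "lin n (\<lambda>i. - a i) x = - lin n a x" for x
      using lin_scale[of n "-1" a x] by simp
    have "prob {x. 6 * real k \<le> \<bar>lin n a x\<bar>}
        \<le> prob ({x. 6 * real k \<le> lin n a x} \<union> {x. 6 * real k \<le> lin n (\<lambda>i. - a i) x})"
      by (intro finite_measure_mono) (auto simp: m intro!: sets_Collect_mu sets.Un)
    also have "\<dots> \<le> prob {x. 6 * real k \<le> lin n a x} + prob {x. 6 * real k \<le> lin n (\<lambda>i. - a i) x}"
      by (intro measure_Un_le) (auto intro!: sets_Collect_mu)
    also have "\<dots> \<le> (1 / 2) ^ k + (1 / 2) ^ k"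
    proof (intro add_mono one)
      have "lin n (\<lambda>i. - a i) = (\<lambda>x. - lin n a x)" by (simp add: m fun_eq_iff)
      then show "integrable \<mu> (lin n (\<lambda>i. - a i))" "(\<integral>x. \<bar>lin n (\<lambda>i. - a i) x\<bar> \<partial>\<mu>) \<le> 1"
        using int E by simp_all
    qed (use int E in auto)
    finally show ?thesis by simp
  qed
  have pw: "ennreal ((lin n a x)\<^sup>2)
      \<le> (\<Sum>k. ennreal (36 * (real k + 1)\<^sup>2) * indicator {x. 6 * real k \<le> \<bar>lin n a x\<bar>} x)" for x
  proof -
    define k where "k = nat \<lfloor>\<bar>lin n a x\<bar> / 6\<rfloor>"
    have k: "6 * real k \<le> \<bar>lin n a x\<bar>" "\<bar>lin n a x\<bar> \<le> 6 * (real k + 1)"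
    proof -
      have "\<exists>k. k = nat \<lfloor>y / 6\<rfloor> \<and> 6 * real k \<le> y \<and> y \<le> 6 * (real k + 1)" if "0 \<le> y" for y :: real
      proof -
        have "real (nat \<lfloor>y / 6\<rfloor>) = of_int \<lfloor>y / 6\<rfloor>" using that by simp
        moreover have "of_int \<lfloor>y / 6\<rfloor> \<le> y / 6" by (rule of_int_floor_le)
        moreover have "y / 6 \<le> of_int \<lfloor>y / 6\<rfloor> + 1" by (rule real_of_int_floor_add_one_ge)
        ultimately have "6 * real (nat \<lfloor>y / 6\<rfloor>) \<le> y" "y \<le> 6 * (real (nat \<lfloor>y / 6\<rfloor>) + 1)"
          by (simp_all only:) (simp_all add: field_simps)
        then show ?thesis by blast
      qed
      from this[of "\<bar>lin n a x\<bar>"]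
      show "6 * real k \<le> \<bar>lin n a x\<bar>" "\<bar>lin n a x\<bar> \<le> 6 * (real k + 1)" by (auto simp: k_def)
    qed
    have "(lin n a x)\<^sup>2 = \<bar>lin n a x\<bar>\<^sup>2" by simp
    also have "\<dots> \<le> (6 * (real k + 1))\<^sup>2" using k by (intro power_mono) auto
    also have "\<dots> = 36 * (real k + 1)\<^sup>2" by (simp add: power2_eq_square algebra_simps)
    finally have "ennreal ((lin n a x)\<^sup>2) \<le> ennreal (36 * (real k + 1)\<^sup>2) * indicator {x. 6 * real k \<le> \<bar>lin n a x\<bar>} x"
      using k by (simp add: ennreal_leI)
    also have "\<dots> \<le> (\<Sum>j. ennreal (36 * (real j + 1)\<^sup>2) * indicator {x. 6 * real j \<le> \<bar>lin n a x\<bar>} x)"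
    proof -
      have "f k \<le> (\<Sum>j. f j)" for f :: "nat \<Rightarrow> ennreal"
        using sum_le_suminf[of f "{k}"] by simp
      then show ?thesis .
    qed
    finally show ?thesis .
  qed
  have "(\<integral>\<^sup>+x. ennreal ((lin n a x)\<^sup>2) \<partial>\<mu>)
      \<le> (\<integral>\<^sup>+x. (\<Sum>k. ennreal (36 * (real k + 1)\<^sup>2) * indicator {x. 6 * real k \<le> \<bar>lin n a x\<bar>} x) \<partial>\<mu>)"
    by (intro nn_integral_mono pw)
  also have "\<dots> = (\<Sum>k. \<integral>\<^sup>+x. ennreal (36 * (real k + 1)\<^sup>2) * indicator {x. 6 * real k \<le> \<bar>lin n a x\<bar>} x \<partial>\<mu>)"
    by (intro nn_integral_suminf borel_measurable_times borel_measurable_indicator sets_Collect_mu) auto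
  also have "\<dots> = (\<Sum>k. ennreal (36 * (real k + 1)\<^sup>2 * prob {x. 6 * real k \<le> \<bar>lin n a x\<bar>}))"
  proof (rule suminf_cong)
    fix k
    have "{x. 6 * real k \<le> \<bar>lin n a x\<bar>} \<in> sets \<mu>" by (intro sets_Collect_mu) measurable
    then show "(\<integral>\<^sup>+x. ennreal (36 * (real k + 1)\<^sup>2) * indicator {x. 6 * real k \<le> \<bar>lin n a x\<bar>} x \<partial>\<mu>)
      = ennreal (36 * (real k + 1)\<^sup>2 * prob {x. 6 * real k \<le> \<bar>lin n a x\<bar>})"
      by (subst nn_integral_cmult_indicator) (simp_all add: emeasure_eq_measure ennreal_mult)
  qed
  also have "\<dots> \<le> (\<Sum>k. ennreal (72 * (real k + 1)\<^sup>2 * (1 / 2) ^ k))"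
  proof (intro suminf_le ennreal_leI)
    fix k
    have "36 * (real k + 1)\<^sup>2 * prob {x. 6 * real k \<le> \<bar>lin n a x\<bar>} \<le> 36 * (real k + 1)\<^sup>2 * (2 * (1 / 2) ^ k)"
      by (intro mult_left_mono tail) auto
    then show "36 * (real k + 1)\<^sup>2 * prob {x. 6 * real k \<le> \<bar>lin n a x\<bar>} \<le> 72 * (real k + 1)\<^sup>2 * (1 / 2) ^ k"
      by simp
  qed auto
  also have "\<dots> = ennreal borell_const"
    unfolding borell_const_def by (intro suminf_ennreal2 summable_borell_const) auto
  finally show ?thesis .
qed

text \<open>A reverse Hoelder inequality: dividing by the first absolute moment \<open>e\<close>
  reduces it to the normalized case. If \<open>e = 0\<close>, the functional vanishes almost surely
  and is treated apart.\<close>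

lemma second_moment:
  assumes int: "integrable \<mu> (lin n a)"
  shows "integrable \<mu> (\<lambda>x. (lin n a x)\<^sup>2)"
    and "(\<integral>x. (lin n a x)\<^sup>2 \<partial>\<mu>) \<le> borell_const * (\<integral>x. \<bar>lin n a x\<bar> \<partial>\<mu>)\<^sup>2"
proof -
  define e where "e = (\<integral>x. \<bar>lin n a x\<bar> \<partial>\<mu>)"
  have "integrable \<mu> (\<lambda>x. (lin n a x)\<^sup>2) \<and> (\<integral>x. (lin n a x)\<^sup>2 \<partial>\<mu>) \<le> borell_const * e\<^sup>2"
  proof (cases "e = 0")
    case True
    then have "AE x in \<mu>. \<bar>lin n a x\<bar> = 0"
      unfolding e_def using int by (subst (asm) integral_nonneg_eq_0_iff_AE) auto
    then have z: "AE x in \<mu>. (lin n a x)\<^sup>2 = 0" by (auto elim!: AE_mp)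
    then have "integrable \<mu> (\<lambda>x. (lin n a x)\<^sup>2)" 
      by (subst integrable_cong_AE[where g="\<lambda>_. 0"]) auto
    moreover have "(\<integral>x. (lin n a x)\<^sup>2 \<partial>\<mu>) = 0"
      using z by (rule integral_eq_zero_AE)
    ultimately show ?thesis using True by simp
  next
    case False
    have "0 \<le> e" unfolding e_def by (intro integral_nonneg_AE) auto
    with False have e: "0 < e" by simp
    have le: "lin n (\<lambda>i. (1 / e) * a i) = (\<lambda>x. lin n a x / e)"
      unfolding lin_scale by simp
    have "integrable \<mu> (lin n (\<lambda>i. (1 / e) * a i))" "(\<integral>x. \<bar>lin n (\<lambda>i. (1 / e) * a i) x\<bar> \<partial>\<mu>) \<le> 1"
      unfolding le using int e by (auto simp: abs_divide e_def[symmetric])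
    from second_moment_normalized[OF this]
    have bd: "(\<integral>\<^sup>+x. ennreal ((lin n a x / e)\<^sup>2) \<partial>\<mu>) \<le> ennreal borell_const" unfolding le .
    have i: "integrable \<mu> (\<lambda>x. (lin n a x / e)\<^sup>2)"
      using bd by (intro integrableI_bounded) (auto simp: le_less_trans)
    have "ennreal (\<integral>x. (lin n a x / e)\<^sup>2 \<partial>\<mu>) \<le> ennreal borell_const"
      using bd nn_integral_eq_integral[OF i] by simp
    then have "(\<integral>x. (lin n a x / e)\<^sup>2 \<partial>\<mu>) \<le> borell_const"
      using borell_const_pos by simp
    then have "(\<integral>x. (lin n a x)\<^sup>2 \<partial>\<mu>) / e\<^sup>2 \<le> borell_const"
      by (simp add: power_divide)
    moreover have "integrable \<mu> (\<lambda>x. e\<^sup>2 * (lin n a x / e)\<^sup>2)" using i by simp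
    moreover have "(\<lambda>x. e\<^sup>2 * (lin n a x / e)\<^sup>2) = (\<lambda>x. (lin n a x)\<^sup>2)"
      using e by (auto simp: power_divide)
    ultimately show ?thesis using e by (simp add: field_simps)
  qed
  then show "integrable \<mu> (\<lambda>x. (lin n a x)\<^sup>2)"
    and "(\<integral>x. (lin n a x)\<^sup>2 \<partial>\<mu>) \<le> borell_const * (\<integral>x. \<bar>lin n a x\<bar> \<partial>\<mu>)\<^sup>2"
    by (auto simp: e_def)
qed

text \<open>The first absolute moment is at least \<open>k\<close>. Since the mean is 0, the sum of
  the functional and its absolute value has the same integral, all of it carried by the positive
  side. The unit second moment forbids that it comes from small values or from a set of small
  measure.\<close>

lemma centered_half_space:
  assumes int: "integrable \<mu> (lin n a)" and mean: "(\<integral>x. lin n a x \<partial>\<mu>) = 0"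
    and var: "(\<integral>x. (lin n a x)\<^sup>2 \<partial>\<mu>) = 1"
  shows "1 / (8 * borell_const) \<le> prob {x. 1 / (8 * sqrt borell_const) \<le> lin n a x}"
proof -
  define k where "k = 1 / sqrt borell_const"
  have k: "0 < k" "k\<^sup>2 = 1 / borell_const"
    using borell_const_pos by (auto simp: k_def power_divide)
  let ?P = "{x. k / 8 \<le> lin n a x}"
  have P: "?P \<in> sets \<mu>" by (intro sets_Collect_mu) measurable
  define e where "e = (\<integral>x. \<bar>lin n a x\<bar> \<partial>\<mu>)"
  have e0: "0 \<le> e" unfolding e_def by (intro integral_nonneg_AE) auto
  have "1 \<le> borell_const * e\<^sup>2"
    using second_moment(2)[OF int] var by (simp add: e_def)
  then have "k\<^sup>2 \<le> e\<^sup>2" unfolding k(2) using borell_const_pos by (simp add: divide_le_eq mult.commute)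
  then have ke: "k \<le> e" using e0 by (rule power2_le_imp_le)
  have sq: "integrable \<mu> (\<lambda>x. (lin n a x)\<^sup>2)" by (rule second_moment(1)[OF int])
  have "e = (\<integral>x. \<bar>lin n a x\<bar> + lin n a x \<partial>\<mu>)"
    using int mean by (simp add: e_def)
  \<comment> \<open>Below \<open>k / 8\<close> the left side is at most \<open>k / 4\<close>; above,
    it is twice the functional and AM-GM applies. The coefficients are chosen so that the first two
    terms integrate to \<open>k / 2\<close>, leaving half of \<open>k\<close> for the
    probability.\<close>
  also have "\<dots> \<le> (\<integral>x. k / 4 + (k / 4) * (lin n a x)\<^sup>2 + (4 / k) * indicator ?P x \<partial>\<mu>)"
  proof (rule integral_mono)
    show "integrable \<mu> (\<lambda>x. k / 4 + (k / 4) * (lin n a x)\<^sup>2 + (4 / k) * indicator ?P x)"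
      using sq P by (auto intro!: Bochner_Integration.integrable_add integrable_mult_right integrable_real_indicator
          simp: emeasure_eq_measure)
    fix x
    show "\<bar>lin n a x\<bar> + lin n a x \<le> k / 4 + (k / 4) * (lin n a x)\<^sup>2 + (4 / k) * indicator ?P x"
    proof (cases "k / 8 \<le> lin n a x")
      case True
      have "0 \<le> (k / 4) * (lin n a x - 4 / k)\<^sup>2" using k by simp
      also have "\<dots> = (k / 4) * (lin n a x)\<^sup>2 - 2 * lin n a x + 4 / k"
        using k(1) by (simp add: power2_eq_square field_simps)
      finally show ?thesis using True k by simp
    next
      case False
      have "0 \<le> (k / 4) * (lin n a x)\<^sup>2" using k by simp
      moreover have "\<bar>lin n a x\<bar> + lin n a x \<le> k / 4" using False k(1) by (auto simp: abs_if)
      ultimately have "\<bar>lin n a x\<bar> + lin n a x \<le> k / 4 + (k / 4) * (lin n a x)\<^sup>2" by linarith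
      then show ?thesis using False by simp
    qed
  qed (use int in auto)
  also have "\<dots> = k / 4 + k / 4 + (4 / k) * prob ?P"
  proof -
    have "integrable \<mu> (\<lambda>x. indicator ?P x :: real)"
      using P by (simp add: emeasure_eq_measure)
    then show ?thesis using sq var P by simp
  qed
  finally have "k / 2 \<le> (4 / k) * prob ?P" using ke by simp
  then have "k\<^sup>2 / 8 \<le> prob ?P" using k by (simp add: field_simps power2_eq_square)
  then show ?thesis using k by (simp add: k_def power_divide mult.commute)
qed

section \<open>Geometry of the linear functionals in L^2(\<mu>)\<close>

lemma integrable_lin_mult:
  assumes int: "\<And>a. integrable \<mu> (lin n a)"
  shows "integrable \<mu> (\<lambda>x. lin n a x * lin n b x)"
proof (rule Bochner_Integration.integrable_bound)
  show "integrable \<mu> (\<lambda>x. (lin n a x)\<^sup>2 + (lin n b x)\<^sup>2)"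
    using second_moment(1)[OF int] by (intro Bochner_Integration.integrable_add)
  have "\<bar>u * v\<bar> \<le> u\<^sup>2 + v\<^sup>2" for u v :: real
  proof -
    have "0 \<le> (\<bar>u\<bar> - \<bar>v\<bar>)\<^sup>2" by simp
    then have "2 * (\<bar>u\<bar> * \<bar>v\<bar>) \<le> u\<^sup>2 + v\<^sup>2" by (simp add: power2_diff)
    moreover have "0 \<le> \<bar>u\<bar> * \<bar>v\<bar>" by simp
    ultimately show ?thesis by (simp only: abs_mult)
  qed
  then show "AE x in \<mu>. norm (lin n a x * lin n b x) \<le> norm ((lin n a x)\<^sup>2 + (lin n b x)\<^sup>2)"
    by (auto intro!: AE_I2)
qed measurable

text \<open>A functional with zero second moment would confine the measure to a hyperplane through
  the origin. This is where nondegeneracy of \<mu> enters.\<close>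

lemma second_moment_pos:
  assumes int: "\<And>a. integrable \<mu> (lin n a)" and a: "\<exists>i<n. a i \<noteq> 0"
  shows "0 < (\<integral>x. (lin n a x)\<^sup>2 \<partial>\<mu>)"
proof (rule ccontr)
  assume "\<not> 0 < (\<integral>x. (lin n a x)\<^sup>2 \<partial>\<mu>)"
  moreover have "0 \<le> (\<integral>x. (lin n a x)\<^sup>2 \<partial>\<mu>)" by (intro integral_nonneg_AE) auto
  ultimately have "(\<integral>x. (lin n a x)\<^sup>2 \<partial>\<mu>) = 0" by simp
  then have "AE x in \<mu>. (lin n a x)\<^sup>2 = 0"
    using second_moment(1)[OF int] by (subst (asm) integral_nonneg_eq_0_iff_AE) auto
  with AE_Rn have "AE x in \<mu>. x \<in> hyperplane_Rn n a 0"
    by eventually_elim (auto simp: hyperplane_Rn_def lin_def)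
  then have "prob (hyperplane_Rn n a 0) = 1"
    by (subst (asm) AE_in_set_eq_1) (auto simp: sets_hyperplane_Rn)
  moreover have "prob (hyperplane_Rn n a 0) < 1"
    using lc a by (simp add: log_concave_prob_def)
  ultimately show False by simp
qed

text \<open>Gram--Schmidt applied in \<open>L\<^sup>2(\<mu>)\<close> to the coordinate functionals.\<close>

lemma orthonormal_functionals_upto:
  assumes int: "\<And>a. integrable \<mu> (lin n a)"
  shows "k \<le> n \<Longrightarrow> \<exists>u. (\<forall>i<k. \<forall>j<k. (\<integral>x. lin n (u i) x * lin n (u j) x \<partial>\<mu>) = (if i = j then 1 else 0)) \<and>
      (\<forall>j<k. \<forall>i\<ge>k. u j i = 0) \<and>
      (\<forall>m<k. \<exists>c. \<forall>x. x m = (\<Sum>j<k. c j * lin n (u j) x))"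
proof (induction k)
  case 0
  then show ?case by auto
next
  case (Suc k)
  from Suc.IH[OF Suc_leD[OF Suc.prems]] obtain u where
    u: "\<forall>i<k. \<forall>j<k. (\<integral>x. lin n (u i) x * lin n (u j) x \<partial>\<mu>) = (if i = j then 1 else 0)"
      "\<forall>j<k. \<forall>i\<ge>k. u j i = 0" "\<forall>m<k. \<exists>c. \<forall>x. x m = (\<Sum>j<k. c j * lin n (u j) x)"
    by (elim exE conjE)
  have on: "\<And>i j. i < k \<Longrightarrow> j < k \<Longrightarrow> (\<integral>x. lin n (u i) x * lin n (u j) x \<partial>\<mu>) = (if i = j then 1 else 0)"
    and supp: "\<And>i j. j < k \<Longrightarrow> k \<le> i \<Longrightarrow> u j i = 0"
    and span: "\<And>m. m < k \<Longrightarrow> \<exists>c. \<forall>x. x m = (\<Sum>j<k. c j * lin n (u j) x)"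
    using u by blast+
  have kn: "k < n" using Suc.prems by simp
  define ek where "ek i = (if i = k then 1 else 0 :: real)" for i
  have ek: "lin n ek x = x k" for x
  proof -
    have "lin n ek x = (\<Sum>i<n. if i = k then x i else 0)"
      unfolding lin_def ek_def by (intro sum.cong) auto
    then show ?thesis using kn by simp
  qed
  define b where "b j = (\<integral>x. lin n ek x * lin n (u j) x \<partial>\<mu>)" for j
  define v where "v i = ek i - (\<Sum>j<k. b j * u j i)" for i
  have v: "lin n v x = lin n ek x - (\<Sum>j<k. b j * lin n (u j) x)" for x
  proof -
    have "lin n v x = lin n ek x - (\<Sum>i<n. \<Sum>j<k. b j * u j i * x i)"
      unfolding lin_def v_def by (simp add: left_diff_distrib sum_subtractf sum_distrib_right)
    also have "(\<Sum>i<n. \<Sum>j<k. b j * u j i * x i) = (\<Sum>j<k. b j * lin n (u j) x)"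
      unfolding lin_def by (subst sum.swap) (simp add: sum_distrib_left mult.assoc)
    finally show ?thesis .
  qed
  \<comment> \<open>The earlier \<open>u j\<close> vanish at index \<open>k\<close>, so the residual
    keeps coefficient 1 there and can be normalized.\<close>
  have "v k = 1" using supp by (simp add: v_def ek_def)
  then have vpos: "0 < (\<integral>x. (lin n v x)\<^sup>2 \<partial>\<mu>)"
    using kn by (intro second_moment_pos int) auto
  define r where "r = sqrt (\<integral>x. (lin n v x)\<^sup>2 \<partial>\<mu>)"
  have r: "0 < r" "r\<^sup>2 = (\<integral>x. (lin n v x)\<^sup>2 \<partial>\<mu>)" using vpos by (auto simp: r_def)
  have orth: "(\<integral>x. lin n v x * lin n (u j) x \<partial>\<mu>) = 0" if j: "j < k" for j
  proof -
    have "(\<integral>x. lin n v x * lin n (u j) x \<partial>\<mu>)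
        = (\<integral>x. lin n ek x * lin n (u j) x - (\<Sum>i<k. b i * (lin n (u i) x * lin n (u j) x)) \<partial>\<mu>)"
      by (simp add: v left_diff_distrib sum_distrib_right mult.assoc)
    also have "\<dots> = b j - (\<Sum>i<k. b i * (\<integral>x. lin n (u i) x * lin n (u j) x \<partial>\<mu>))"
      using integrable_lin_mult[OF int] by (simp add: b_def)
    also have "(\<Sum>i<k. b i * (\<integral>x. lin n (u i) x * lin n (u j) x \<partial>\<mu>)) = (\<Sum>i<k. if i = j then b i else 0)"
      using on j by (intro sum.cong) auto
    also have "\<dots> = b j" using j by simp
    finally show ?thesis by simp
  qed
  define w where "w = u(k := (\<lambda>i. (1 / r) * v i))"
  have wk: "lin n (w k) x = lin n v x / r" for x
    unfolding w_def fun_upd_same lin_scale by simp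
  have wj: "w j = u j" if "j < k" for j using that by (simp add: w_def)
  show ?case
  proof (intro exI[of _ w] conjI allI impI)
    fix i j assume "i < Suc k" "j < Suc k"
    then consider "i < k" "j < k" | "i = k" "j < k" | "i < k" "j = k" | "i = k" "j = k"
      by (auto simp: less_Suc_eq)
    then show "(\<integral>x. lin n (w i) x * lin n (w j) x \<partial>\<mu>) = (if i = j then 1 else 0)"
    proof cases
      case 1
      then show ?thesis using on by (simp add: wj)
    next
      case 2
      then show ?thesis using orth[of j] by (simp add: wk wj)
    next
      case 3
      then show ?thesis using orth[of i] by (simp add: wk wj mult.commute)
    next
      case 4
      have "(\<integral>x. lin n (w k) x * lin n (w k) x \<partial>\<mu>) = (\<integral>x. (lin n v x)\<^sup>2 / r\<^sup>2 \<partial>\<mu>)"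
        by (simp add: wk power2_eq_square)
      also have "\<dots> = 1" using r vpos by simp
      finally show ?thesis using 4 by simp
    qed
  next
    fix j i assume "j < Suc k" "Suc k \<le> i"
    then show "w j i = 0"
      using supp by (auto simp: w_def v_def ek_def)
  next
    fix m assume "m < Suc k"
    then consider "m < k" | "m = k" by linarith
    then show "\<exists>c. \<forall>x. x m = (\<Sum>j<Suc k. c j * lin n (w j) x)"
    proof cases
      case 1
      then obtain c where "\<forall>x. x m = (\<Sum>j<k. c j * lin n (u j) x)" using span by blast
      moreover have "(\<Sum>j<Suc k. (c(k := 0)) j * lin n (w j) x) = (\<Sum>j<k. c j * lin n (u j) x)" for x
        by (simp add: wj)
      ultimately show ?thesis by (intro exI[of _ "c(k := 0)"]) metis
    next
      case 2
      \<comment> \<open>Solving the Gram--Schmidt step for the coordinate: its residual is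
        \<open>r\<close> times the new functional.\<close>
      have "x m = (\<Sum>j<Suc k. (b(k := r)) j * lin n (w j) x)" for x
        using v[of x] r 2 by (simp add: wk wj ek)
      then show ?thesis by blast
    qed
  qed
qed

lemma orthonormal_functionals:
  assumes int: "\<And>a. integrable \<mu> (lin n a)"
  obtains u where "\<And>i j. i < n \<Longrightarrow> j < n \<Longrightarrow> (\<integral>x. lin n (u i) x * lin n (u j) x \<partial>\<mu>) = (if i = j then 1 else 0)"
    and "\<And>a. \<exists>c. \<forall>x. lin n a x = (\<Sum>j<n. c j * lin n (u j) x)"
proof -
  from orthonormal_functionals_upto[OF int order_refl] obtain u where
    u: "\<forall>i<n. \<forall>j<n. (\<integral>x. lin n (u i) x * lin n (u j) x \<partial>\<mu>) = (if i = j then 1 else 0)"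
      "\<forall>j<n. \<forall>i\<ge>n. u j i = 0" "\<forall>m<n. \<exists>c. \<forall>x. x m = (\<Sum>j<n. c j * lin n (u j) x)"
    by (elim exE conjE)
  have on: "\<And>i j. i < n \<Longrightarrow> j < n \<Longrightarrow> (\<integral>x. lin n (u i) x * lin n (u j) x \<partial>\<mu>) = (if i = j then 1 else 0)"
    and span: "\<And>m. m < n \<Longrightarrow> \<exists>c. \<forall>x. x m = (\<Sum>j<n. c j * lin n (u j) x)"
    using u by blast+
  from span obtain c where c: "\<forall>m. m < n \<longrightarrow> (\<forall>x. x m = (\<Sum>j<n. c m j * lin n (u j) x))"
    using choice[of "\<lambda>m c. m < n \<longrightarrow> (\<forall>x. x m = (\<Sum>j<n. c j * lin n (u j) x))"] by blast
  have "lin n a x = (\<Sum>j<n. (\<Sum>m<n. a m * c m j) * lin n (u j) x)" for a x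
  proof -
    have "lin n a x = (\<Sum>m<n. a m * (\<Sum>j<n. c m j * lin n (u j) x))"
      unfolding lin_def[of n a x] by (intro sum.cong refl arg_cong2[where f="(*)"] c[rule_format]) simp
    also have "\<dots> = (\<Sum>m<n. \<Sum>j<n. a m * c m j * lin n (u j) x)"
      by (simp add: sum_distrib_left mult.assoc)
    also have "\<dots> = (\<Sum>j<n. (\<Sum>m<n. a m * c m j) * lin n (u j) x)"
      by (subst sum.swap) (simp add: sum_distrib_right)
    finally show ?thesis .
  qed
  then have "\<exists>c. \<forall>x. lin n a x = (\<Sum>j<n. c j * lin n (u j) x)" for a
    by (intro exI[of _ "\<lambda>j. \<Sum>m<n. a m * c m j"] allI)
  with on show thesis by (rule that)
qed

end

subsection \<open>Convex hulls of finitely many points\<close>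

text \<open>Weights from index \<open>N\<close> on are fixed to 0, whereas
  \<open>scaled_hull\<close> leaves them arbitrary. The image is the same, but this parameter set is
  compact in \<open>nat \<Rightarrow> real\<close>.\<close>

definition simplex_weights :: "nat \<Rightarrow> (nat \<Rightarrow> real) set" where
  "simplex_weights N = {w. (\<forall>j<N. 0 \<le> w j) \<and> (\<forall>j\<ge>N. w j = 0) \<and> (\<Sum>j<N. w j) = 1}"

lemma compact_simplex_weights: "compact (simplex_weights N)"
proof -
  have "simplex_weights N = {x \<in> Rn N. \<forall>i<N. \<bar>x i\<bar> \<le> 1} \<inter> ((\<Inter>j\<in>{..<N}. {w. 0 \<le> w j}) \<inter> {w. (\<Sum>j<N. w j) = 1})"
  proof -
    have "\<bar>w i\<bar> \<le> 1" if "\<forall>j<N. 0 \<le> w j" "(\<Sum>j<N. w j) = 1" "i < N" for w :: "nat \<Rightarrow> real" and i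
      using that member_le_sum[of i "{..<N}" w] by simp
    then show ?thesis by (auto simp: simplex_weights_def Rn_def)
  qed
  also have "compact \<dots>"
    by (intro compact_Int_closed compact_box_Rn closed_Int closed_INT ballI closed_Collect_le closed_Collect_eq
        continuous_intros continuous_on_product_coordinates)
  finally show ?thesis .
qed

lemma scaled_hull_eq:
  "scaled_hull t N X = (\<lambda>w i. t * (\<Sum>j<N. w j * X j i)) ` simplex_weights N"
proof (intro equalityI subsetI)
  fix y assume "y \<in> scaled_hull t N X"
  then obtain w where w: "y = (\<lambda>i. t * (\<Sum>j<N. w j * X j i))" "\<forall>j<N. 0 \<le> w j" "(\<Sum>j<N. w j) = 1"
    by (auto simp: scaled_hull_def)
  let ?w = "\<lambda>j. if j < N then w j else 0"
  have w': "?w \<in> simplex_weights N" using w by (auto simp: simplex_weights_def)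
  have y: "y = (\<lambda>i. t * (\<Sum>j<N. ?w j * X j i))" using w by simp
  show "y \<in> (\<lambda>w i. t * (\<Sum>j<N. w j * X j i)) ` simplex_weights N"
    by (rule image_eqI[where x = ?w], rule y, rule w')
qed (auto simp: scaled_hull_def simplex_weights_def)

text \<open>The graph is the projection of a closed set of triples (weights, sample, point) along
  the compact factor of weights, and such projections are closed maps. Closedness jointly in sample
  and point is what gives measurability in the sample.\<close>

lemma closed_graph_scaled_hull:
  "closed {p :: (nat \<Rightarrow> nat \<Rightarrow> real) \<times> (nat \<Rightarrow> real). snd p \<in> scaled_hull t N (fst p)}"
proof -
  let ?W = "simplex_weights N"
  let ?T = "{q :: (nat \<Rightarrow> real) \<times> (nat \<Rightarrow> nat \<Rightarrow> real) \<times> (nat \<Rightarrow> real).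
      \<forall>i. snd (snd q) i = t * (\<Sum>j<N. fst q j * fst (snd q) j i)}"
  have y: "continuous_on UNIV (\<lambda>q :: (nat \<Rightarrow> real) \<times> (nat \<Rightarrow> nat \<Rightarrow> real) \<times> (nat \<Rightarrow> real). snd (snd q) i)" for i
    by (rule continuous_on_product_then_coordinatewise, intro continuous_on_snd continuous_on_id)
  have w: "continuous_on UNIV (\<lambda>q :: (nat \<Rightarrow> real) \<times> (nat \<Rightarrow> nat \<Rightarrow> real) \<times> (nat \<Rightarrow> real). fst q j)" for j
    by (rule continuous_on_product_then_coordinatewise, intro continuous_on_fst continuous_on_id)
  have X: "continuous_on UNIV (\<lambda>q :: (nat \<Rightarrow> real) \<times> (nat \<Rightarrow> nat \<Rightarrow> real) \<times> (nat \<Rightarrow> real). fst (snd q) j i)" for i j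
    by (rule continuous_on_product_then_coordinatewise, rule continuous_on_product_then_coordinatewise,
        intro continuous_on_fst continuous_on_snd continuous_on_id)
  have "closed ?T"
    by (intro closed_Collect_all closed_Collect_eq y continuous_on_mult continuous_on_const continuous_on_sum w X)
  then have "closedin euclidean ?T" by simp
  moreover have "prod_topology (top_of_set ?W) euclidean = top_of_set (?W \<times> (UNIV :: ((nat \<Rightarrow> nat \<Rightarrow> real) \<times> (nat \<Rightarrow> real)) set))"
    using prod_topology_subtopology(1)[of euclidean ?W euclidean] by simp
  ultimately have c: "closedin (prod_topology (top_of_set ?W) euclidean) ((?W \<times> UNIV) \<inter> ?T)"
    by (simp add: closedin_closed_Int)
  have "compact_space (top_of_set ?W)"
    using compact_simplex_weights by (simp add: compact_space_subtopology)
  then have "closed_map (prod_topology (top_of_set ?W) (euclidean :: ((nat \<Rightarrow> nat \<Rightarrow> real) \<times> (nat \<Rightarrow> real)) topology)) euclidean snd"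
    by (rule Abstract_Topological_Spaces.closed_map_snd)
  with c have "closed (snd ` ((?W \<times> UNIV) \<inter> ?T))"
    unfolding closed_map_def closed_closedin by blast
  moreover have "snd ` ((?W \<times> UNIV) \<inter> ?T) = {p. snd p \<in> scaled_hull t N (fst p)}"
  proof (intro equalityI subsetI)
    fix p assume "p \<in> {p. snd p \<in> scaled_hull t N (fst p)}"
    then obtain w where "w \<in> ?W" "snd p = (\<lambda>i. t * (\<Sum>j<N. w j * fst p j i))"
      by (auto simp: scaled_hull_eq)
    then have "(w, p) \<in> (?W \<times> UNIV) \<inter> ?T" by simp
    then show "p \<in> snd ` ((?W \<times> UNIV) \<inter> ?T)" by (rule image_eqI[rotated]) simp
  next
    fix p assume "p \<in> snd ` ((?W \<times> UNIV) \<inter> ?T)"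
    then obtain w where "w \<in> ?W" "\<forall>i. snd p i = t * (\<Sum>j<N. w j * fst p j i)" by auto
    then have "w \<in> ?W" "snd p = (\<lambda>i. t * (\<Sum>j<N. w j * fst p j i))" by (auto simp only: fun_eq_iff)
    then show "p \<in> {p. snd p \<in> scaled_hull t N (fst p)}" unfolding scaled_hull_eq by blast
  qed
  ultimately show ?thesis by simp
qed

lemma scaled_hull_cong:
  assumes "\<And>j. j < N \<Longrightarrow> X j = Y j"
  shows "scaled_hull t N X = scaled_hull t N Y"
  using assms unfolding scaled_hull_def by simp

text \<open>The functional is the difference between \<open>x\<close> and its nearest point in the
  hull. If some vertex lay beyond that point in this direction, shifting a little weight to the
  vertex would reduce the distance.\<close>

lemma separating_functional_scaled_hull:
  assumes N: "0 < N" and x: "x \<in> Rn n" and X: "\<And>j. j < N \<Longrightarrow> X j \<in> Rn n"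
    and nin: "x \<notin> scaled_hull t N X"
  obtains a where "\<And>j. j < N \<Longrightarrow> t * lin n a (X j) < lin n a x"
proof -
  define z where "z w i = t * (\<Sum>j<N. w j * X j i)" for w i
  define D where "D w = (\<Sum>i<n. (x i - z w i)\<^sup>2)" for w
  have "(\<lambda>j. if j = 0 then 1 else 0) \<in> simplex_weights N"
    using N by (auto simp: simplex_weights_def)
  then have ne: "simplex_weights N \<noteq> {}" by blast
  have "continuous_on UNIV D"
    unfolding D_def z_def by (intro continuous_intros continuous_on_product_coordinates)
  then have "continuous_on (simplex_weights N) D" by (rule continuous_on_subset) simp
  from continuous_attains_inf[OF compact_simplex_weights ne this]
  obtain w where w: "w \<in> simplex_weights N" and min: "\<And>v. v \<in> simplex_weights N \<Longrightarrow> D w \<le> D v" by blast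
  define d where "d i = x i - z w i" for i
  have D: "D w = lin n d d" by (simp add: D_def d_def lin_def power2_eq_square)
  have Dpos: "0 < lin n d d"
  proof (rule ccontr)
    assume "\<not> 0 < lin n d d"
    moreover have "0 \<le> D w" unfolding D_def by (intro sum_nonneg) auto
    ultimately have "D w = 0" using D by simp
    then have "\<forall>i<n. x i = z w i" unfolding D_def by (subst (asm) sum_nonneg_eq_0_iff) auto
    \<comment> \<open>The distance sees the first \<open>n\<close> coordinates only; the others are
      0 on both sides.\<close>
    moreover have "x i = z w i" if "n \<le> i" for i
      using that x X by (simp add: z_def Rn_def)
    ultimately have "x = z w" by (intro ext) (meson not_le)
    then show False using nin w unfolding scaled_hull_eq z_def by blast
  qed
  have "t * lin n d (X j) \<le> lin n d (z w)" if j: "j < N" for j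
  proof (rule ccontr)
    define e where "e i = t * X j i - z w i" for i
    have le: "lin n d e = t * lin n d (X j) - lin n d (z w)"
      by (simp add: lin_def e_def right_diff_distrib sum_subtractf sum_distrib_left mult.left_commute)
    assume "\<not> t * lin n d (X j) \<le> lin n d (z w)"
    then have pos: "0 < lin n d e" using le by simp
    define Q where "Q = lin n e e"
    have Q: "0 \<le> Q" unfolding Q_def lin_def by (intro sum_nonneg) auto
    \<comment> \<open>The bound 1 keeps the shifted weights in the simplex. The other bound lets the
      linear gain beat the quadratic loss \<open>s^2 * Q\<close>, and the added 1 covers
      \<open>Q = 0\<close>.\<close>
    define s where "s = min 1 (lin n d e / (Q + 1))"
    have s: "0 < s" "s \<le> 1" "s * (Q + 1) \<le> lin n d e"
    proof -
      have "s \<le> lin n d e / (Q + 1)" by (simp add: s_def)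
      then show "s * (Q + 1) \<le> lin n d e" using Q by (subst (asm) pos_le_divide_eq) auto
    qed (use pos Q in \<open>auto simp: s_def\<close>)
    define v where "v k = (1 - s) * w k + s * (if k = j then 1 else 0)" for k
    have "v \<in> simplex_weights N"
      using w s j unfolding simplex_weights_def v_def
      by (auto simp: sum.distrib sum_distrib_left[symmetric] intro!: add_nonneg_nonneg)
    then have "D w \<le> D v" by (rule min)
    have zv: "z v i = z w i + s * e i" for i
    proof -
      have "(\<Sum>k<N. v k * X k i) = (\<Sum>k<N. (1 - s) * (w k * X k i) + s * (if k = j then X k i else 0))"
        by (intro sum.cong) (auto simp: v_def algebra_simps)
      also have "\<dots> = (1 - s) * (\<Sum>k<N. w k * X k i) + s * X j i"
        using j by (simp add: sum.distrib sum_distrib_left[symmetric])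
      finally have eq: "(\<Sum>k<N. v k * X k i) = (1 - s) * (\<Sum>k<N. w k * X k i) + s * X j i" .
      show ?thesis unfolding z_def[of v] eq by (simp add: z_def e_def algebra_simps)
    qed
    have "D v = (\<Sum>i<n. (d i - s * e i)\<^sup>2)"
      unfolding D_def zv d_def by (simp add: algebra_simps)
    also have "\<dots> = lin n d d - 2 * s * lin n d e + s\<^sup>2 * Q"
      unfolding Q_def lin_def sum_distrib_left sum_subtractf[symmetric] sum.distrib[symmetric]
      by (intro sum.cong) (simp_all add: power2_eq_square algebra_simps)
    finally have "2 * s * lin n d e \<le> s\<^sup>2 * Q" using \<open>D w \<le> D v\<close> D by simp
    then have "2 * lin n d e \<le> s * Q" using s by (simp add: power2_eq_square)
    also have "s * Q \<le> s * (Q + 1)" using s by simp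
    also note s(3)
    finally show False using pos by simp
  qed
  moreover have "lin n d x = lin n d (z w) + lin n d d"
    unfolding lin_def sum.distrib[symmetric] by (intro sum.cong) (simp_all add: d_def algebra_simps)
  ultimately have "t * lin n d (X j) < lin n d x" if "j < N" for j
    using that Dpos by (smt (verit))
  then show thesis by (rule that)
qed

section \<open>Measurability of the mass of the random hull\<close>

context log_concave
begin

text \<open>The Bochner integral in \<open>expected_cover\<close> would be the default 0 for a
  nonmeasurable integrand. Measurability follows by taking sections of the closed graph.\<close>

lemma borel_measurable_measure_scaled_hull:
  "(\<lambda>X. prob (scaled_hull t N X)) \<in> borel_measurable (PiM {..<N} (\<lambda>_. \<mu>))"
proof -
  \<comment> \<open>Points of the finite product are \<open>undefined\<close> from index
    \<open>N\<close> on. Replacing these entries by 0 maps into the full sequence space, whose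
    product sets are its Borel sets, and leaves the hull unchanged.\<close>
  define g :: "(nat \<Rightarrow> nat \<Rightarrow> real) \<Rightarrow> nat \<Rightarrow> nat \<Rightarrow> real" where
    "g X j = (if j < N then X j else (\<lambda>_. 0))" for X j
  have "g \<in> PiM {..<N} (\<lambda>_. \<mu>) \<rightarrow>\<^sub>M PiM UNIV (\<lambda>_. borel)"
  proof (rule measurable_PiM_single')
    fix j :: nat
    show "(\<lambda>X. g X j) \<in> PiM {..<N} (\<lambda>_. \<mu>) \<rightarrow>\<^sub>M borel"
    proof (cases "j < N")
      case True
      then have "(\<lambda>X. X j) \<in> PiM {..<N} (\<lambda>_. \<mu>) \<rightarrow>\<^sub>M \<mu>"
        by (intro measurable_component_singleton) auto
      then show ?thesis using True unfolding g_def by (simp cong: measurable_cong_sets)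
    qed (simp add: g_def)
  qed auto
  then have g[measurable]: "g \<in> borel_measurable (PiM {..<N} (\<lambda>_. \<mu>))"
    by (simp add: measurable_cong_sets[OF refl sets_PiM_equal_borel])
  let ?G = "{p \<in> space (PiM {..<N} (\<lambda>_. \<mu>) \<Otimes>\<^sub>M \<mu>). snd p \<in> scaled_hull t N (fst p)}"
  have "(\<lambda>p. (g (fst p), snd p)) \<in> (PiM {..<N} (\<lambda>_. \<mu>) \<Otimes>\<^sub>M \<mu>) \<rightarrow>\<^sub>M (borel \<Otimes>\<^sub>M borel)"
    by measurable
  then have "(\<lambda>p. (g (fst p), snd p)) -` {p. snd p \<in> scaled_hull t N (fst p)} \<inter> space (PiM {..<N} (\<lambda>_. \<mu>) \<Otimes>\<^sub>M \<mu>)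
      \<in> sets (PiM {..<N} (\<lambda>_. \<mu>) \<Otimes>\<^sub>M \<mu>)"
    by (rule measurable_sets) (unfold borel_prod, intro borel_closed closed_graph_scaled_hull)
  moreover have "scaled_hull t N (g X) = scaled_hull t N X" for X
    by (rule scaled_hull_cong) (simp add: g_def)
  ultimately have "?G \<in> sets (PiM {..<N} (\<lambda>_. \<mu>) \<Otimes>\<^sub>M \<mu>)"
    by (simp add: vimage_def Int_def conj_commute)
  from measurable_emeasure_Pair[OF this]
  have "(\<lambda>X. enn2real (emeasure \<mu> (Pair X -` ?G))) \<in> borel_measurable (PiM {..<N} (\<lambda>_. \<mu>))"
    by measurable
  then show ?thesis
    by (rule measurable_cong[THEN iffD1, rotated]) (simp add: measure_def space_pair_measure vimage_def)
qed

subsection \<open>Covering by a random polytope\<close>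

text \<open>The supremum of the levels with tail at least \<open>q\<close> works: it is finite since
  the tail tends to 0, limits from the left give the closed tail, and limits from the right the
  strict one. The two tails are kept apart because the law of \<open>Z\<close> may have an atom at
  \<open>s\<close>.\<close>

lemma quantile_exists:
  fixes Z :: "(nat \<Rightarrow> real) \<Rightarrow> real"
  assumes Z[measurable]: "Z \<in> borel_measurable borel" and G[measurable]: "Measurable.pred borel G"
    and q: "0 < q" and s0: "q \<le> prob {x. G x \<and> s0 \<le> Z x}"
  obtains s where "s0 \<le> s" "q \<le> prob {x. G x \<and> s \<le> Z x}" "prob {x. G x \<and> s < Z x} \<le> q"
proof -
  define F where "F s = prob {x. G x \<and> s \<le> Z x}" for s
  have ev: "{x. G x \<and> s \<le> Z x} \<in> events" for s
    by (intro sets_Collect_mu) measurable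
  have anti: "F t \<le> F s" if "s \<le> t" for s t
    unfolding F_def using that ev by (intro finite_measure_mono) auto
  have "(\<lambda>k. prob {x. G x \<and> real k \<le> Z x}) \<longlonglongrightarrow> prob (\<Inter>k. {x. G x \<and> real k \<le> Z x})"
    using ev by (intro finite_Lim_measure_decseq) (auto simp: decseq_def)
  moreover have "(\<Inter>k. {x. G x \<and> real k \<le> Z x}) = {}"
  proof -
    have "\<exists>k. \<not> real k \<le> Z x" for x
      using reals_Archimedean2[of "Z x"] by (auto simp: not_le)
    then show ?thesis by blast
  qed
  ultimately have "(\<lambda>k. F (real k)) \<longlonglongrightarrow> 0" by (simp add: F_def)
  then have "eventually (\<lambda>k. F (real k) < q) sequentially" using q by (rule order_tendstoD)
  then obtain k where k: "F (real k) < q" by (auto simp: eventually_sequentially)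
  let ?A = "{s. q \<le> F s}"
  have bdd: "bdd_above ?A"
  proof (rule bdd_aboveI)
    fix s assume "s \<in> ?A"
    then show "s \<le> real k" using anti[of "real k" s] k by force
  qed
  have s0A: "s0 \<in> ?A" using s0 by (simp add: F_def)
  define s where "s = Sup ?A"
  have "s0 \<le> s" unfolding s_def using s0A bdd by (rule cSup_upper)
  moreover have "q \<le> prob {x. G x \<and> s \<le> Z x}"
  proof -
    have "(\<lambda>k. prob {x. G x \<and> s - 1 / real (Suc k) \<le> Z x}) \<longlonglongrightarrow> prob (\<Inter>k. {x. G x \<and> s - 1 / real (Suc k) \<le> Z x})"
    proof (rule finite_Lim_measure_decseq)
      show "decseq (\<lambda>k. {x. G x \<and> s - 1 / real (Suc k) \<le> Z x})"
      proof (rule decseq_SucI)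
        fix k
        have "1 / real (Suc (Suc k)) \<le> 1 / real (Suc k)" by (intro divide_left_mono) auto
        then show "{x. G x \<and> s - 1 / real (Suc (Suc k)) \<le> Z x} \<subseteq> {x. G x \<and> s - 1 / real (Suc k) \<le> Z x}" by auto
      qed
    qed (use ev in auto)
    moreover have "(\<Inter>k. {x. G x \<and> s - 1 / real (Suc k) \<le> Z x}) = {x. G x \<and> s \<le> Z x}"
    proof (intro equalityI subsetI)
      fix x assume x: "x \<in> (\<Inter>k. {x. G x \<and> s - 1 / real (Suc k) \<le> Z x})"
      have "s \<le> Z x"
      proof (rule ccontr)
        assume "\<not> s \<le> Z x"
        then obtain k where "1 / real (Suc k) < s - Z x" using nat_approx_posE[of "s - Z x"] by auto
        moreover have "s - 1 / real (Suc k) \<le> Z x" using x by blast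
        ultimately show False by linarith
      qed
      then show "x \<in> {x. G x \<and> s \<le> Z x}" using x by blast
    next
      fix x assume "x \<in> {x. G x \<and> s \<le> Z x}"
      moreover have "0 \<le> 1 / real (Suc k)" for k by simp
      ultimately show "x \<in> (\<Inter>k. {x. G x \<and> s - 1 / real (Suc k) \<le> Z x})" by (smt (verit) INT_I mem_Collect_eq)
    qed
    ultimately have "(\<lambda>k. F (s - 1 / real (Suc k))) \<longlonglongrightarrow> prob {x. G x \<and> s \<le> Z x}"
      by (simp add: F_def)
    moreover have "q \<le> F (s - 1 / real (Suc k))" for k
    proof -
      have "s - 1 / real (Suc k) < Sup ?A" by (simp add: s_def)
      then obtain t where "t \<in> ?A" "s - 1 / real (Suc k) < t" using s0A by (auto elim: less_cSupE)
      then show ?thesis using anti[of "s - 1 / real (Suc k)" t] by auto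
    qed
    ultimately show ?thesis by (intro LIMSEQ_le_const) auto
  qed
  moreover have "prob {x. G x \<and> s < Z x} \<le> q"
  proof -
    have "(\<lambda>k. prob {x. G x \<and> s + 1 / real (Suc k) \<le> Z x}) \<longlonglongrightarrow> prob (\<Union>k. {x. G x \<and> s + 1 / real (Suc k) \<le> Z x})"
    proof (rule finite_Lim_measure_incseq)
      show "incseq (\<lambda>k. {x. G x \<and> s + 1 / real (Suc k) \<le> Z x})"
      proof (rule incseq_SucI)
        fix k
        have "1 / real (Suc (Suc k)) \<le> 1 / real (Suc k)" by (intro divide_left_mono) auto
        then show "{x. G x \<and> s + 1 / real (Suc k) \<le> Z x} \<subseteq> {x. G x \<and> s + 1 / real (Suc (Suc k)) \<le> Z x}" by auto
      qed
    qed (use ev in auto)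
    moreover have "(\<Union>k. {x. G x \<and> s + 1 / real (Suc k) \<le> Z x}) = {x. G x \<and> s < Z x}"
    proof (intro equalityI subsetI)
      fix x assume x: "x \<in> {x. G x \<and> s < Z x}"
      then obtain k where "1 / real (Suc k) < Z x - s" using nat_approx_posE[of "Z x - s"] by auto
      then have "s + 1 / real (Suc k) \<le> Z x" by linarith
      then show "x \<in> (\<Union>k. {x. G x \<and> s + 1 / real (Suc k) \<le> Z x})" using x by blast
    next
      fix x assume "x \<in> (\<Union>k. {x. G x \<and> s + 1 / real (Suc k) \<le> Z x})"
      then obtain k where k: "G x" "s + 1 / real (Suc k) \<le> Z x" by blast
      moreover have "0 < 1 / real (Suc k)" by simp
      ultimately show "x \<in> {x. G x \<and> s < Z x}" by (smt (verit) mem_Collect_eq)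
    qed
    ultimately have "(\<lambda>k. F (s + 1 / real (Suc k))) \<longlonglongrightarrow> prob {x. G x \<and> s < Z x}"
      by (simp add: F_def)
    moreover have "F (s + 1 / real (Suc k)) \<le> q" for k
    proof (rule ccontr)
      assume "\<not> F (s + 1 / real (Suc k)) \<le> q"
      then have "s + 1 / real (Suc k) \<in> ?A" by simp
      then have "s + 1 / real (Suc k) \<le> s" unfolding s_def using bdd by (rule cSup_upper)
      moreover have "0 < 1 / real (Suc k)" by simp
      ultimately show False by linarith
    qed
    ultimately show ?thesis by (intro LIMSEQ_le_const2) auto
  qed
  ultimately show thesis by (rule that)
qed

lemma prob_PiM_all:
  assumes A: "A \<in> sets borel"
  shows "measure (PiM {..<N} (\<lambda>_. \<mu>)) {X \<in> space (PiM {..<N} (\<lambda>_. \<mu>)). \<forall>j<N. X j \<in> A} = prob A ^ N"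
proof -
  interpret P: product_prob_space "\<lambda>_. \<mu>" "{..<N}" ..
  have "{X \<in> space (PiM {..<N} (\<lambda>_. \<mu>)). \<forall>j<N. X j \<in> A} = {X \<in> space (PiM {..<N} (\<lambda>_. \<mu>)). \<forall>j\<in>{..<N}. X j \<in> A}"
    by auto
  then have "emeasure (PiM {..<N} (\<lambda>_. \<mu>)) {X \<in> space (PiM {..<N} (\<lambda>_. \<mu>)). \<forall>j<N. X j \<in> A} = (\<Prod>j\<in>{..<N}. emeasure \<mu> A)"
    using A by (simp only:) (intro P.emeasure_PiM_Collect, auto)
  also have "\<dots> = ennreal (prob A ^ N)"
    by (simp add: emeasure_eq_measure ennreal_power)
  finally show ?thesis by (simp add: measure_def)
qed

end

lemma round_to_grid:
  fixes t :: real
  assumes m: "0 < m" and t: "\<bar>t\<bar> \<le> 1"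
  obtains k :: int where "k \<in> {- int m..int m}" "\<bar>of_int k / real m - t\<bar> \<le> 1 / real m"
proof -
  define k where "k = \<lfloor>real m * t\<rfloor>"
  have a: "of_int k \<le> real m * t" "real m * t < of_int k + 1" unfolding k_def by linarith+
  have b: "real m * t \<le> real m * 1" "real m * (-1) \<le> real m * t"
    using t m by (intro mult_left_mono; simp)+
  have "of_int k \<le> real m" "- real m < of_int k + 1" using a b by linarith+
  then have "k \<in> {- int m..int m}" by auto
  moreover have "\<bar>of_int k / real m - t\<bar> = \<bar>of_int k - real m * t\<bar> / real m"
  proof -
    have "of_int k / real m - t = (of_int k - real m * t) / real m" using m by (simp add: field_simps)
    then show ?thesis by simp
  qed
  moreover have "\<dots> \<le> 1 / real m"
    using a by (intro divide_right_mono) auto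
  ultimately show thesis by (intro that[of k]) auto
qed

context log_concave
begin

lemma integrable_measure_scaled_hull:
  "integrable (PiM {..<N} (\<lambda>_. \<mu>)) (\<lambda>X. prob (scaled_hull t N X))"
proof -
  interpret P: prob_space "PiM {..<N} (\<lambda>_. \<mu>)" by (intro prob_space_PiM prob_space_axioms)
  show ?thesis
    by (rule P.integrable_const_bound[where B=1]) (auto simp: borel_measurable_measure_scaled_hull)
qed

lemma expected_cover_le_1: "expected_cover \<mu> N d \<le> 1"
proof -
  interpret P: prob_space "PiM {..<N} (\<lambda>_. \<mu>)" by (intro prob_space_PiM prob_space_axioms)
  show ?thesis unfolding expected_cover_def
    by (intro P.integral_le_const integrable_measure_scaled_hull) auto
qed

text \<open>The first factor bounds the mass of a set \<open>G\<close> of good points, the second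
  the probability of an event \<Omega> on which the sample covers \<open>G\<close>. Hypothesis
  \<open>q\<close> lets a half-space keep mass \<open>q\<close> after truncation; hypothesis
  \<open>m\<close> bounds the rounding error \<eta> by \<open>d * c0 / 8\<close>.\<close>

lemma expected_cover_lower_bound:
  fixes m N :: nat and R q d :: real
  assumes bary: "barycenter_origin n \<mu>"
    and pos: "0 < R" "0 < m" "0 < N" "0 < d" "d \<le> 1" "0 < q" "q \<le> 1"
    and q: "real n / R + q \<le> 1 / (8 * borell_const)"
    and m: "8 * R / real m \<le> d * (1 / (8 * sqrt borell_const))"
    and nonneg: "0 \<le> 1 - real n / R - (2 * real m + 1) ^ n * q"
  shows "(1 - real n / R - (2 * real m + 1) ^ n * q) * (1 - (2 * real m + 1) ^ n * (1 - q) ^ N)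
    \<le> expected_cover \<mu> N d"
proof -
  define c0 where "c0 = 1 / (8 * sqrt borell_const)"
  have c0: "0 < c0" using borell_const_pos by (simp add: c0_def)
  define \<eta> where "\<eta> = R / real m"
  have \<eta>: "0 < \<eta>" "8 * \<eta> \<le> d * c0" using pos m by (auto simp: \<eta>_def c0_def)
  have "d * c0 \<le> c0" using pos c0 by (simp add: mult_left_le_one_le)
  with \<eta> have \<eta>': "8 * \<eta> \<le> c0" by linarith
  have int: "integrable \<mu> (lin n a)" and mean: "(\<integral>x. lin n a x \<partial>\<mu>) = 0" for a
    using bary unfolding lin_def barycenter_origin_def by auto
  obtain u where on: "\<And>i j. i < n \<Longrightarrow> j < n \<Longrightarrow> (\<integral>x. lin n (u i) x * lin n (u j) x \<partial>\<mu>) = (if i = j then 1 else 0)"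
    and span: "\<And>a. \<exists>c. \<forall>x. lin n a x = (\<Sum>j<n. c j * lin n (u j) x)"
    using orthonormal_functionals[OF int] by blast
  \<comment> \<open>The l1 norm in isotropic coordinates: its mean is at most \<open>n\<close>, and
    it controls the effect of rounding each coefficient by \<open>1 / m\<close>.\<close>
  define S where "S x = (\<Sum>j<n. \<bar>lin n (u j) x\<bar>)" for x
  define Y where "Y c x = (\<Sum>j<n. c j * lin n (u j) x)" for c x
  have [measurable]: "S \<in> borel_measurable borel" unfolding S_def by measurable
  have [measurable]: "Y c \<in> borel_measurable borel" for c unfolding Y_def by measurable
  have Yscale: "Y (\<lambda>j. k * c j) x = k * Y c x" for k c x
    by (simp add: Y_def sum_distrib_left mult.assoc)
  have S_tail: "prob {x. R \<le> S x} \<le> real n / R"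
  proof -
    have one: "(\<integral>x. \<bar>lin n (u j) x\<bar> \<partial>\<mu>) \<le> 1" if "j < n" for j
    proof -
      have "(\<integral>x. \<bar>lin n (u j) x\<bar> \<partial>\<mu>) \<le> (\<integral>x. (1 + (lin n (u j) x)\<^sup>2) / 2 \<partial>\<mu>)"
      proof (rule integral_mono)
        show "integrable \<mu> (\<lambda>x. (1 + (lin n (u j) x)\<^sup>2) / 2)"
          using second_moment(1)[OF int] by auto
        show "\<bar>lin n (u j) x\<bar> \<le> (1 + (lin n (u j) x)\<^sup>2) / 2" for x
        proof -
          have "0 \<le> (\<bar>lin n (u j) x\<bar> - 1)\<^sup>2" by simp
          then show ?thesis by (simp add: power2_diff)
        qed
      qed (use int in auto)
      also have "\<dots> = 1"
        using second_moment(1)[OF int, of "u j"] on[OF that that] by (simp add: power2_eq_square)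
      finally show ?thesis .
    qed
    have "(\<integral>x. S x \<partial>\<mu>) = (\<Sum>j<n. \<integral>x. \<bar>lin n (u j) x\<bar> \<partial>\<mu>)"
      unfolding S_def using int by (intro Bochner_Integration.integral_sum) auto
    also have "\<dots> \<le> (\<Sum>j<n. 1)" using one by (intro sum_mono) auto
    finally have ES: "(\<integral>x. S x \<partial>\<mu>) \<le> real n" by simp
    have "prob {x \<in> space \<mu>. R \<le> S x} \<le> (\<integral>x. S x \<partial>\<mu>) / R"
      using int pos by (intro integral_Markov_inequality_measure[where A="{}"]) (auto simp: S_def intro!: sum_nonneg)
    also have "\<dots> \<le> real n / R" using ES pos by (intro divide_right_mono) auto
    finally show ?thesis by simp
  qed
  have Y_diff: "\<bar>Y b x - Y c x\<bar> \<le> \<eta>" if "\<And>j. j < n \<Longrightarrow> \<bar>b j - c j\<bar> \<le> 1 / real m" "S x \<le> R" for b c x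
  proof -
    have "\<bar>Y b x - Y c x\<bar> = \<bar>\<Sum>j<n. (b j - c j) * lin n (u j) x\<bar>"
      by (simp add: Y_def sum_subtractf left_diff_distrib)
    also have "\<dots> \<le> (\<Sum>j<n. \<bar>b j - c j\<bar> * \<bar>lin n (u j) x\<bar>)"
      by (rule order_trans[OF sum_abs]) (simp add: abs_mult)
    also have "\<dots> \<le> (\<Sum>j<n. 1 / real m * \<bar>lin n (u j) x\<bar>)"
      using that by (intro sum_mono mult_right_mono) auto
    also have "\<dots> = S x / real m" by (simp add: S_def sum_divide_distrib)
    also have "\<dots> \<le> \<eta>" unfolding \<eta>_def using that pos by (intro divide_right_mono) auto
    finally show ?thesis .
  qed
  define T where "T = PiE {..<n} (\<lambda>_. (\<lambda>k. of_int k / real m) ` {- int m..int m})"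
  have T: "finite T" "real (card T) \<le> (2 * real m + 1) ^ n"
  proof -
    show "finite T" unfolding T_def by (intro finite_PiE) auto
    have "card ((\<lambda>k. of_int k / real m) ` {- int m..int m}) \<le> card {- int m..int m}"
      by (rule card_image_le) simp
    also have "\<dots> = 2 * m + 1" by simp
    finally have "card ((\<lambda>k. of_int k / real m) ` {- int m..int m}) ^ n \<le> (2 * m + 1) ^ n"
      by (intro power_mono) auto
    moreover have "card T = card ((\<lambda>k. of_int k / real m) ` {- int m..int m}) ^ n"
      unfolding T_def by (subst card_PiE) auto
    ultimately have "card T \<le> (2 * m + 1) ^ n" by simp
    then have "real (card T) \<le> real ((2 * m + 1) ^ n)" by (rule of_nat_mono)
    then show "real (card T) \<le> (2 * real m + 1) ^ n" by (simp add: add.commute)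
  qed
  \<comment> \<open>The grid also contains short vectors such as 0, whose quantiles may be small.
    Those kept admit a quantile of at least \<open>c0 / 2\<close>.\<close>
  define T' where "T' = {b \<in> T. q \<le> prob {x. S x \<le> R \<and> c0 / 2 \<le> Y b x}}"
  have T': "finite T'" "real (card T') \<le> (2 * real m + 1) ^ n"
  proof -
    show "finite T'" using T by (simp add: T'_def)
    have "card T' \<le> card T" using T by (intro card_mono) (auto simp: T'_def)
    then show "real (card T') \<le> (2 * real m + 1) ^ n" using T by linarith
  qed
  have "\<forall>b\<in>T'. \<exists>s. c0 / 2 \<le> s \<and> q \<le> prob {x. S x \<le> R \<and> s \<le> Y b x} \<and> prob {x. S x \<le> R \<and> s < Y b x} \<le> q"
  proof
    fix b assume b: "b \<in> T'"
    have Z: "Y b \<in> borel_measurable borel" and G: "Measurable.pred borel (\<lambda>x. S x \<le> R)" by measurable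
    have "q \<le> prob {x. S x \<le> R \<and> c0 / 2 \<le> Y b x}" using b by (simp add: T'_def)
    from quantile_exists[OF Z G pos(6) this]
    show "\<exists>s. c0 / 2 \<le> s \<and> q \<le> prob {x. S x \<le> R \<and> s \<le> Y b x} \<and> prob {x. S x \<le> R \<and> s < Y b x} \<le> q"
      by blast
  qed
  from bchoice[OF this] obtain s where
    "\<forall>b\<in>T'. c0 / 2 \<le> s b \<and> q \<le> prob {x. S x \<le> R \<and> s b \<le> Y b x} \<and> prob {x. S x \<le> R \<and> s b < Y b x} \<le> q"
    by blast
  then have s: "\<And>b. b \<in> T' \<Longrightarrow> c0 / 2 \<le> s b"
      "\<And>b. b \<in> T' \<Longrightarrow> q \<le> prob {x. S x \<le> R \<and> s b \<le> Y b x}"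
      "\<And>b. b \<in> T' \<Longrightarrow> prob {x. S x \<le> R \<and> s b < Y b x} \<le> q"
    by blast+
  define G where "G = {x. x \<in> Rn n \<and> S x \<le> R \<and> (\<forall>b\<in>T'. Y b x \<le> s b)}"
  have G_sets: "G \<in> events" unfolding G_def using T'(1) by (intro sets_Collect_mu) measurable
  have G: "1 - real n / R - (2 * real m + 1) ^ n * q \<le> prob G"
  proof -
    have ev: "- Rn n \<in> events" "{x. R \<le> S x} \<in> events" "{x. S x \<le> R \<and> s b < Y b x} \<in> events" for b
      by (auto intro!: sets_Collect_mu)
    have "prob (space \<mu> - G) \<le> prob ((- Rn n \<union> {x. R \<le> S x}) \<union> (\<Union>b\<in>T'. {x. S x \<le> R \<and> s b < Y b x}))"
      using ev T'(1) by (intro finite_measure_mono) (auto simp: G_def not_le intro!: sets.Un sets.finite_UN)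
    also have "\<dots> \<le> prob (- Rn n \<union> {x. R \<le> S x}) + prob (\<Union>b\<in>T'. {x. S x \<le> R \<and> s b < Y b x})"
      using ev T'(1) by (intro measure_Un_le) (auto intro!: sets.Un sets.finite_UN)
    also have "\<dots> \<le> (prob (- Rn n) + prob {x. R \<le> S x}) + (\<Sum>b\<in>T'. prob {x. S x \<le> R \<and> s b < Y b x})"
      using ev T'(1) by (intro add_mono measure_Un_le finite_measure_subadditive_finite) auto
    also have "prob (- Rn n) = 0"
      using prob_compl[of "Rn n"] lc by (simp add: log_concave_prob_def Compl_eq_Diff_UNIV)
    also have "(\<Sum>b\<in>T'. prob {x. S x \<le> R \<and> s b < Y b x}) \<le> (\<Sum>b\<in>T'. q)"
      using s(3) by (intro sum_mono) auto
    also have "\<dots> = real (card T') * q" by simp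
    also have "\<dots> \<le> (2 * real m + 1) ^ n * q" using T'(2) pos by (intro mult_right_mono) auto
    finally have "prob (space \<mu> - G) \<le> real n / R + (2 * real m + 1) ^ n * q" using S_tail by simp
    then show ?thesis using prob_compl[OF G_sets] by simp
  qed
  let ?P = "PiM {..<N} (\<lambda>_. \<mu>)"
  interpret P: prob_space ?P by (intro prob_space_PiM prob_space_axioms)
  define E where "E b = {x. S x \<le> R \<and> s b \<le> Y b x}" for b
  have E_sets: "E b \<in> events" for b unfolding E_def by (intro sets_Collect_mu) measurable
  \<comment> \<open>Up to a null event, the complement is a union over \<open>T'\<close> of the
    events that all \<open>N\<close> points miss \<open>E b\<close>, each of probability at most
    \<open>(1 - q) ^ N\<close>.\<close>
  define \<Omega> where "\<Omega> = {X \<in> space ?P. (\<forall>j<N. X j \<in> Rn n) \<and> (\<forall>b\<in>T'. \<exists>j<N. X j \<in> E b)}"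
  have all_sets: "{X \<in> space ?P. \<forall>j<N. X j \<in> A} \<in> P.events" if "A \<in> events" for A
  proof -
    have "{X \<in> space ?P. \<forall>j<N. X j \<in> A} = {X \<in> space ?P. \<forall>j\<in>{..<N}. X j \<in> A}" by auto
    also have "\<dots> \<in> P.events"
      using that pos(3)
      by (intro sets.sets_Collect_finite_All' sets_Collect_single') (auto simp: lessThan_empty_iff)
    finally show ?thesis .
  qed
  have \<Omega>_eq: "\<Omega> = {X \<in> space ?P. \<forall>j<N. X j \<in> Rn n} - (\<Union>b\<in>T'. {X \<in> space ?P. \<forall>j<N. X j \<in> space \<mu> - E b})"
    unfolding \<Omega>_def by auto
  have \<Omega>_sets: "\<Omega> \<in> P.events"
    unfolding \<Omega>_eq using T'(1) E_sets by (intro sets.Diff sets.finite_UN all_sets) auto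
  have \<Omega>: "1 - (2 * real m + 1) ^ n * (1 - q) ^ N \<le> P.prob \<Omega>"
  proof -
    have full: "P.prob {X \<in> space ?P. \<forall>j<N. X j \<in> Rn n} = 1"
      using prob_PiM_all[of "Rn n" N] lc by (simp add: log_concave_prob_def)
    have miss: "P.prob {X \<in> space ?P. \<forall>j<N. X j \<in> space \<mu> - E b} \<le> (1 - q) ^ N" if "b \<in> T'" for b
    proof -
      have "P.prob {X \<in> space ?P. \<forall>j<N. X j \<in> space \<mu> - E b} = prob (space \<mu> - E b) ^ N"
        using E_sets[of b] by (intro prob_PiM_all) (metis sets_mu sets.compl_sets)
      also have "\<dots> \<le> (1 - q) ^ N"
        using s(2)[OF that] prob_compl[OF E_sets[of b]] by (intro power_mono) (auto simp: E_def)
      finally show ?thesis .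
    qed
    let ?U = "\<Union>b\<in>T'. {X \<in> space ?P. \<forall>j<N. X j \<in> space \<mu> - E b}"
    have U: "?U \<in> P.events" using T'(1) E_sets by (intro sets.finite_UN all_sets) auto
    have "P.prob ?U \<le> (\<Sum>b\<in>T'. P.prob {X \<in> space ?P. \<forall>j<N. X j \<in> space \<mu> - E b})"
      using T'(1) E_sets by (intro P.finite_measure_subadditive_finite) (auto intro!: all_sets)
    also have "\<dots> \<le> (\<Sum>b\<in>T'. (1 - q) ^ N)" using miss by (intro sum_mono) auto
    also have "\<dots> = real (card T') * (1 - q) ^ N" by simp
    also have "\<dots> \<le> (2 * real m + 1) ^ n * (1 - q) ^ N" using T'(2) pos by (intro mult_right_mono) auto
    finally have le: "P.prob ?U \<le> (2 * real m + 1) ^ n * (1 - q) ^ N" .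
    have "1 = P.prob {X \<in> space ?P. \<forall>j<N. X j \<in> Rn n}" using full by simp
    also have "\<dots> \<le> P.prob (\<Omega> \<union> ?U)"
    proof (rule P.finite_measure_mono)
      show "{X \<in> space ?P. \<forall>j<N. X j \<in> Rn n} \<subseteq> \<Omega> \<union> ?U"
        by (simp only: \<Omega>_eq Un_Diff_cancel2 Un_upper1)
    qed (rule sets.Un[OF \<Omega>_sets U])
    also have "\<dots> \<le> P.prob \<Omega> + P.prob ?U" using \<Omega>_sets U by (rule measure_Un_le)
    finally show ?thesis using le by linarith
  qed
  have cover: "G \<subseteq> scaled_hull (1 + d) N X" if X: "X \<in> \<Omega>" for X
  proof
    fix x assume x: "x \<in> G"
    show "x \<in> scaled_hull (1 + d) N X"
    proof (rule ccontr)
      assume nin: "x \<notin> scaled_hull (1 + d) N X"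
      have xR: "x \<in> Rn n" using x by (simp add: G_def)
      have XR: "X j \<in> Rn n" if "j < N" for j using X that by (simp add: \<Omega>_def)
      obtain a where a: "\<And>j. j < N \<Longrightarrow> (1 + d) * lin n a (X j) < lin n a x"
        using separating_functional_scaled_hull[OF pos(3) xR XR nin] by blast
      obtain c where c: "\<And>x. lin n a x = Y c x" using span[of a] unfolding Y_def by blast
      define r where "r = sqrt (\<Sum>j<n. (c j)\<^sup>2)"
      \<comment> \<open>Zero coefficients would make the functional vanish, against strict
        separation from the sample point of index 0.\<close>
      have r: "0 < r"
      proof (rule ccontr)
        assume "\<not> 0 < r"
        moreover have "0 \<le> (\<Sum>j<n. (c j)\<^sup>2)" by (intro sum_nonneg) auto
        ultimately have "(\<Sum>j<n. (c j)\<^sup>2) = 0" by (simp add: r_def)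
        then have "\<forall>j<n. c j = 0" by (subst (asm) sum_nonneg_eq_0_iff) auto
        then have "lin n a y = 0" for y by (simp add: c Y_def)
        then show False using a[OF pos(3)] by simp
      qed
      define e where "e j = (1 / r) * c j" for j
      have Ye: "Y e y = lin n (\<lambda>i. (1 / r) * a i) y" for y
        unfolding e_def Yscale lin_scale c ..
      have e2: "(\<Sum>j<n. (e j)\<^sup>2) = 1"
      proof -
        have "(\<Sum>j<n. (e j)\<^sup>2) = (\<Sum>j<n. (c j)\<^sup>2) / r\<^sup>2"
          by (simp add: e_def power_divide sum_divide_distrib)
        also have "(\<Sum>j<n. (c j)\<^sup>2) = r\<^sup>2"
          unfolding r_def by (simp add: sum_nonneg)
        finally show ?thesis using r by simp
      qed
      have sep: "(1 + d) * Y e (X j) < Y e x" if "j < N" for j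
      proof -
        have "(1 / r) * ((1 + d) * lin n a (X j)) < (1 / r) * lin n a x"
          using a[OF that] r by (intro mult_strict_left_mono) auto
        then show ?thesis unfolding Ye lin_scale by (simp add: mult_ac)
      qed
      have "(\<integral>y. (Y e y)\<^sup>2 \<partial>\<mu>) = 1"
      proof -
        have "(\<integral>y. (Y e y)\<^sup>2 \<partial>\<mu>) = (\<integral>y. (\<Sum>i<n. \<Sum>j<n. e i * e j * (lin n (u i) y * lin n (u j) y)) \<partial>\<mu>)"
          by (simp add: Y_def power2_eq_square sum_product mult_ac)
        also have "\<dots> = (\<Sum>i<n. \<Sum>j<n. e i * e j * (\<integral>y. lin n (u i) y * lin n (u j) y \<partial>\<mu>))"
          using integrable_lin_mult[OF int] by simp
        also have "\<dots> = (\<Sum>i<n. \<Sum>j<n. if j = i then e i * e j else 0)"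
          using on by (intro sum.cong refl) auto
        also have "\<dots> = (\<Sum>i<n. (e i)\<^sup>2)" by (simp add: power2_eq_square)
        finally show ?thesis using e2 by simp
      qed
      then have half: "1 / (8 * borell_const) \<le> prob {y. c0 \<le> Y e y}"
        using centered_half_space[OF int mean, of "\<lambda>i. (1 / r) * a i"] unfolding Ye c0_def by simp
      have e1: "\<bar>e j\<bar> \<le> 1" if "j < n" for j
      proof -
        have "(e j)\<^sup>2 \<le> (\<Sum>j<n. (e j)\<^sup>2)" using that by (intro member_le_sum) auto
        then show ?thesis using e2 abs_le_square_iff[of "e j" 1] by simp
      qed
      have "\<exists>k\<in>{- int m..int m}. \<bar>of_int k / real m - e j\<bar> \<le> 1 / real m" if "j < n" for j
        using round_to_grid[OF pos(2) e1[OF that]] by blast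
      then have "\<forall>j\<in>{..<n}. \<exists>k. k \<in> {- int m..int m} \<and> \<bar>of_int k / real m - e j\<bar> \<le> 1 / real m" by blast
      from bchoice[OF this] obtain k where
        "\<forall>j\<in>{..<n}. k j \<in> {- int m..int m} \<and> \<bar>of_int (k j) / real m - e j\<bar> \<le> 1 / real m" by blast
      then have k: "\<And>j. j < n \<Longrightarrow> k j \<in> {- int m..int m}"
        "\<And>j. j < n \<Longrightarrow> \<bar>of_int (k j) / real m - e j\<bar> \<le> 1 / real m" by blast+
      define b where "b = (\<lambda>j\<in>{..<n}. of_int (k j) / real m)"
      have be: "\<bar>b j - e j\<bar> \<le> 1 / real m" if "j < n" for j using k(2)[OF that] that by (simp add: b_def)
      have near: "\<bar>Y b y - Y e y\<bar> \<le> \<eta>" if "S y \<le> R" for y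
        using Y_diff[OF be that] .
      have "b \<in> T" unfolding T_def b_def using k(1) by (intro restrict_PiE_iff[THEN iffD2]) auto
      \<comment> \<open>Of the mass beyond \<open>c0\<close>, truncation removes at most
        \<open>n / R\<close>, and rounding lowers the threshold by \<eta>, at most
        \<open>c0 / 8\<close>. Hence the rounded direction belongs to \<open>T'\<close>.\<close>
      moreover have "q \<le> prob {y. S y \<le> R \<and> c0 / 2 \<le> Y b y}"
      proof -
        have "prob {y. c0 \<le> Y e y} \<le> prob ({y. S y \<le> R \<and> c0 / 2 \<le> Y b y} \<union> {y. R \<le> S y})"
        proof (rule finite_measure_mono)
          show "{y. c0 \<le> Y e y} \<subseteq> {y. S y \<le> R \<and> c0 / 2 \<le> Y b y} \<union> {y. R \<le> S y}"
          proof
            fix y assume "y \<in> {y. c0 \<le> Y e y}"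
            then have "c0 \<le> Y e y" by simp
            then show "y \<in> {y. S y \<le> R \<and> c0 / 2 \<le> Y b y} \<union> {y. R \<le> S y}"
              using near[of y] \<eta>' c0 by (cases "S y \<le> R") (auto simp: abs_le_iff)
          qed
        qed (auto intro!: sets.Un sets_Collect_mu)
        also have "\<dots> \<le> prob {y. S y \<le> R \<and> c0 / 2 \<le> Y b y} + prob {y. R \<le> S y}"
          by (intro measure_Un_le sets_Collect_mu) measurable
        finally show ?thesis using half S_tail q by linarith
      qed
      ultimately have b: "b \<in> T'" by (simp add: T'_def)
      obtain j where j: "j < N" "S (X j) \<le> R" "s b \<le> Y b (X j)"
        using X b by (auto simp: \<Omega>_def E_def)
      have xb: "S x \<le> R" "Y b x \<le> s b" using x b by (auto simp: G_def)
      \<comment> \<open>Through the quantile: \<open>Y e x\<close> is at most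
        \<open>s b + \<eta>\<close>, and \<open>s b\<close> is at most
        \<open>Y e (X j) + \<eta>\<close>. As \<open>Y e (X j)\<close> is at least
        \<open>c0 / 4\<close>, the gain \<open>d * (c0 / 4)\<close> would fall below
        \<open>2 * \<eta>\<close>, against \<open>8 * \<eta> \<le> d * c0\<close>.\<close>
      have "(1 + d) * Y e (X j) < Y e (X j) + 2 * \<eta>"
        using sep[OF j(1)] near[OF xb(1)] near[OF j(2)] xb(2) j(3) by (auto simp: abs_le_iff)
      then have "d * Y e (X j) < 2 * \<eta>" by (simp add: algebra_simps)
      moreover have "c0 / 4 \<le> Y e (X j)"
        using s(1)[OF b] j(3) near[OF j(2)] \<eta>' \<eta>(1) c0 by (auto simp: abs_le_iff)
      then have "d * (c0 / 4) \<le> d * Y e (X j)" using pos by (intro mult_left_mono) auto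
      ultimately show False using \<eta> by simp
    qed
  qed
  have "prob G * P.prob \<Omega> = (\<integral>X. prob G * indicator \<Omega> X \<partial>?P)" using \<Omega>_sets by simp
  also have "\<dots> \<le> (\<integral>X. prob (scaled_hull (1 + d) N X) \<partial>?P)"
  proof (rule integral_mono)
    show "integrable ?P (\<lambda>X. prob G * indicator \<Omega> X)"
      using \<Omega>_sets by (auto simp: P.emeasure_eq_measure)
    show "integrable ?P (\<lambda>X. prob (scaled_hull (1 + d) N X))"
      by (rule integrable_measure_scaled_hull)
    fix X assume "X \<in> space ?P"
    show "prob G * indicator \<Omega> X \<le> prob (scaled_hull (1 + d) N X)"
    proof (cases "X \<in> \<Omega>")
      case True
      have "compact (scaled_hull (1 + d) N X)"
      proof -
        have "continuous_on UNIV (\<lambda>w i. (1 + d) * (\<Sum>j<N. w j * X j i))"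
          by (intro continuous_on_coordinatewise_then_product continuous_intros continuous_on_product_coordinates)
        then show ?thesis unfolding scaled_hull_eq
          by (intro compact_continuous_image compact_simplex_weights) (rule continuous_on_subset, auto)
      qed
      then have "scaled_hull (1 + d) N X \<in> events" by (auto intro: borel_compact)
      then have "prob G \<le> prob (scaled_hull (1 + d) N X)"
        using cover[OF True] by (rule finite_measure_mono[rotated])
      then show ?thesis using True by simp
    qed simp
  qed
  finally have "prob G * P.prob \<Omega> \<le> expected_cover \<mu> N d" by (simp add: expected_cover_def)
  \<comment> \<open>The second factor on the left may be negative, so the nonnegative first factor
    is held fixed while the second is replaced.\<close>
  moreover have "(1 - real n / R - (2 * real m + 1) ^ n * q) * (1 - (2 * real m + 1) ^ n * (1 - q) ^ N) \<le> prob G * P.prob \<Omega>"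
  proof -
    have "(1 - real n / R - (2 * real m + 1) ^ n * q) * (1 - (2 * real m + 1) ^ n * (1 - q) ^ N)
        \<le> (1 - real n / R - (2 * real m + 1) ^ n * q) * P.prob \<Omega>"
      using \<Omega> nonneg by (intro mult_left_mono)
    also have "\<dots> \<le> prob G * P.prob \<Omega>" using G by (intro mult_right_mono) auto
    finally show ?thesis .
  qed
  ultimately show ?thesis by linarith
qed

end

section \<open>Choice of parameters and the limit in \<open>n\<close>\<close>

lemma (in log_concave) expected_cover_ge:
  fixes N :: nat and d :: real
  assumes bary: "barycenter_origin n \<mu>" and d: "0 < d" "d < 1" and n3: "3 \<le> n"
    and n1: "2 / real n \<le> 1 / (8 * borell_const)"
    and n2: "8 / real n \<le> d * (1 / (8 * sqrt borell_const))"
    and N: "real n ^ (12 * n) \<le> real N"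
  shows "1 - 3 / real n \<le> expected_cover \<mu> N d"
proof -
  \<comment> \<open>These make \<open>n / R\<close> equal to \<open>1 / n\<close> and
    \<open>R / m\<close> equal to \<open>1 / n^2\<close>. The grid size is at most
    \<open>(3 * n ^ 4) ^ n\<close>, hence at most \<open>n ^ (5 * n)\<close> for
    \<open>n \<ge> 3\<close>, and \<open>q\<close> beats its inverse by a factor
    \<open>n ^ n\<close>.\<close>
  define R where "R = (real n)\<^sup>2"
  define m where "m = n ^ 4"
  define q where "q = 1 / real n ^ (6 * n)"
  define K where "K = (2 * real m + 1) ^ n"
  have n: "0 < real n" "1 \<le> real n" "3 \<le> real n" using n3 by auto
  have pw: "real n \<le> real n ^ k" if "0 < k" for k
    using n that self_le_power[of "real n" k] by simp
  have nR: "real n / R = 1 / real n" using n by (simp add: R_def power2_eq_square)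
  have q: "0 < q" "q \<le> 1 / real n" "q \<le> 1"
  proof -
    show "0 < q" using n by (simp add: q_def)
    show "q \<le> 1 / real n" unfolding q_def using n n3 pw[of "6 * n"] by (intro divide_left_mono) auto
    also have "\<dots> \<le> 1" using n by simp
    finally show "q \<le> 1" .
  qed
  have K: "0 \<le> K" "K \<le> real n ^ (5 * n)"
  proof -
    show "0 \<le> K" by (simp add: K_def)
    have "2 * real m + 1 \<le> 3 * real n ^ 4"
      using one_le_power[OF n(2), of 4] by (simp add: m_def)
    also have "\<dots> \<le> real n * real n ^ 4" using n by (intro mult_right_mono) auto
    also have "\<dots> = real n ^ 5" by (simp add: eval_nat_numeral)
    finally have "K \<le> (real n ^ 5) ^ n" unfolding K_def by (intro power_mono) auto
    then show "K \<le> real n ^ (5 * n)" by (simp add: power_mult)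
  qed
  have inv: "1 / real n ^ n \<le> 1 / real n" using n n3 pw[of n] by (intro divide_left_mono) auto
  have Kq: "K * q \<le> 1 / real n"
  proof -
    have "K * q \<le> real n ^ (5 * n) * q" using K q by (intro mult_right_mono) auto
    also have "\<dots> = 1 / real n ^ n"
    proof -
      have "real n ^ (6 * n) = real n ^ (5 * n) * real n ^ n" by (simp add: power_add[symmetric])
      then show ?thesis using n by (simp add: q_def)
    qed
    finally show ?thesis using inv by linarith
  qed
  have N0: "0 < real N" using N n zero_less_power[OF n(1), of "12 * n"] by linarith
  have KN: "K * (1 - q) ^ N \<le> 1 / real n"
  proof -
    \<comment> \<open>The crude bound \<open>exp (- y) \<le> 1 / y\<close> suffices: the exponent
      \<open>12 * n = 5 * n + 6 * n + n\<close> pays for the grid, for \<open>1 / q\<close>, and for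
      a remaining \<open>n ^ n\<close>.\<close>
    have "(1 - q) ^ N \<le> exp (- q) ^ N"
      using q exp_ge_add_one_self[of "- q"] by (intro power_mono) auto
    also have "\<dots> = 1 / exp (q * real N)"
      by (simp add: exp_of_nat_mult[symmetric] exp_minus[symmetric] inverse_eq_divide[symmetric] mult.commute)
    also have "\<dots> \<le> 1 / (q * real N)"
    proof (rule divide_left_mono)
      show "q * real N \<le> exp (q * real N)" using exp_ge_add_one_self[of "q * real N"] by linarith
    qed (use q N0 in auto)
    also have "\<dots> \<le> 1 / (q * real n ^ (12 * n))"
      using q N N0 n by (intro divide_left_mono mult_left_mono mult_pos_pos) auto
    finally have "K * (1 - q) ^ N \<le> real n ^ (5 * n) * (1 / (q * real n ^ (12 * n)))"
      using K q by (intro mult_mono) auto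
    also have "\<dots> = 1 / real n ^ n"
    proof -
      have "real n ^ (12 * n) = real n ^ (5 * n) * real n ^ (6 * n) * real n ^ n" by (simp add: power_add[symmetric])
      then show ?thesis using n by (simp add: q_def)
    qed
    finally show ?thesis using inv by linarith
  qed
  have "1 - 3 / real n \<le> (1 - 2 / real n) * (1 - 1 / real n)"
    using n by (simp add: field_simps)
  also have "\<dots> \<le> (1 - real n / R - K * q) * (1 - K * (1 - q) ^ N)"
  proof -
    have "2 / real n = 1 / real n + 1 / real n" "1 / real n \<le> 1 / 3" using n by (auto simp: field_simps)
    then show ?thesis using Kq KN nR by (intro mult_mono) linarith+
  qed
  also have "\<dots> \<le> expected_cover \<mu> N d"
    unfolding K_def
  proof (rule expected_cover_lower_bound[OF bary])
    show "0 < R" "0 < m" "0 < N" "0 < d" "d \<le> 1" "0 < q" "q \<le> 1"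
      using n n3 N0 d q by (auto simp: R_def m_def)
    show "real n / R + q \<le> 1 / (8 * borell_const)" using nR q n1 by simp
    have "8 * R / real m = 8 / real n * (1 / real n)" using n by (simp add: R_def m_def eval_nat_numeral)
    also have "\<dots> \<le> 8 / real n * 1" using n by (intro mult_left_mono) auto
    finally show "8 * R / real m \<le> d * (1 / (8 * sqrt borell_const))" using n2 by simp
    show "0 \<le> 1 - real n / R - (2 * real m + 1) ^ n * q"
    proof -
      have "2 / real n \<le> 1" using n by simp
      then show ?thesis using nR Kq unfolding K_def by simp
    qed
  qed
  finally show ?thesis .
qed

theorem theorem1p6:
  shows "\<exists>C>0. \<forall>d::real. 0 < d \<and> d < 1 \<longrightarrow>
    (\<lambda>n::nat. Inf {Inf {expected_cover \<mu> N d | N::nat.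
                         real N \<ge> exp (C * (1 / d) * ln (2 / d) * real n * ln (real n))}
                   | \<mu>. log_concave_prob n \<mu> \<and> barycenter_origin n \<mu>})
    \<longlonglongrightarrow> 1"
proof (intro exI[of _ 18] conjI allI impI)
  fix d :: real assume "0 < d \<and> d < 1"
  then have d: "0 < d" "d < 1" by auto
  define I where "I n \<mu> = {expected_cover \<mu> N d | N::nat.
    real N \<ge> exp (18 * (1 / d) * ln (2 / d) * real n * ln (real n))}" for n \<mu>
  define J where "J n = {Inf (I n \<mu>) | \<mu>. log_concave_prob n \<mu> \<and> barycenter_origin n \<mu>}" for n
  have I_ne: "I n \<mu> \<noteq> {}" for n \<mu>
    unfolding I_def using real_arch_simple by blast
  \<comment> \<open>The witness 18 comes from \<open>ln 2 \<ge> 2 / 3\<close>. Since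
    \<open>1 / d\<close> exceeds 1 and \<open>ln (2 / d)\<close> exceeds \<open>ln 2\<close>, the
    prescribed sample size is at least \<open>n ^ (12 * n)\<close>.\<close>
  have coeff: "12 \<le> 18 * (1 / d) * ln (2 / d)"
  proof -
    have "12 \<le> 18 * (1 * ln (2::real))" using ln2_ge_two_thirds by simp
    also have "\<dots> \<le> 18 * ((1 / d) * ln (2 / d))"
      using d by (intro mult_left_mono mult_mono) (auto simp: field_simps)
    finally show ?thesis by simp
  qed
  have ev: "eventually (\<lambda>n. 3 \<le> n \<and> 2 / real n \<le> 1 / (8 * borell_const) \<and>
      8 / real n \<le> d * (1 / (8 * sqrt borell_const))) sequentially"
  proof (intro eventually_conj)
    have lim: "(\<lambda>n. c / real n) \<longlonglongrightarrow> 0" for c :: real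
      by (rule lim_const_over_n)
    have "0 < 1 / (8 * borell_const)" "0 < d * (1 / (8 * sqrt borell_const))"
      using borell_const_pos d by auto
    moreover have "\<forall>\<^sub>F n in sequentially. c / real n \<le> a" if "0 < a" for a c :: real
      using order_tendstoD(2)[OF lim that, of c] by (rule eventually_mono) simp
    ultimately show "\<forall>\<^sub>F n in sequentially. 2 / real n \<le> 1 / (8 * borell_const)"
      "\<forall>\<^sub>F n in sequentially. 8 / real n \<le> d * (1 / (8 * sqrt borell_const))"
      by blast+
  qed (rule eventually_ge_at_top)
  have lower: "1 - 3 / real n \<le> v" if n: "3 \<le> n" "2 / real n \<le> 1 / (8 * borell_const)"
      "8 / real n \<le> d * (1 / (8 * sqrt borell_const))" and "log_concave_prob n \<mu>" "barycenter_origin n \<mu>"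
      and v: "v \<in> I n \<mu>" for n \<mu> v
  proof -
    interpret log_concave n \<mu> by standard fact
    obtain N where N: "exp (18 * (1 / d) * ln (2 / d) * real n * ln (real n)) \<le> real N" "v = expected_cover \<mu> N d"
      using v unfolding I_def by auto
    have "real n ^ (12 * n) = exp (12 * (real n * ln (real n)))"
      using n by (simp add: exp_of_nat_mult[symmetric] powr_realpow[symmetric] powr_def)
    also have "\<dots> \<le> exp (18 * (1 / d) * ln (2 / d) * (real n * ln (real n)))"
      using coeff n unfolding exp_le_cancel_iff by (intro mult_right_mono) auto
    also have "\<dots> \<le> real N" using N by (simp add: mult.assoc)
    finally show ?thesis unfolding N(2) using that d by (intro expected_cover_ge) auto
  qed
  have "(\<lambda>n. Inf (J n)) \<longlonglongrightarrow> 1"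
  proof (rule tendsto_sandwich)
    have "(\<lambda>n. 1 - 3 / real n) \<longlonglongrightarrow> 1 - 0" by (intro tendsto_diff tendsto_const lim_const_over_n)
    then show "(\<lambda>n. 1 - 3 / real n) \<longlonglongrightarrow> 1" by simp
    have J: "1 - 3 / real n \<le> w" if n: "3 \<le> n" "2 / real n \<le> 1 / (8 * borell_const)"
      "8 / real n \<le> d * (1 / (8 * sqrt borell_const))" and w: "w \<in> J n" for n w
      using w lower[OF n] I_ne unfolding J_def by (auto intro!: cInf_greatest)
    have cube: "Inf (I n (cube_measure n)) \<in> J n" for n
      unfolding J_def using log_concave_prob_cube barycenter_origin_cube by blast
    show "\<forall>\<^sub>F n in sequentially. 1 - 3 / real n \<le> Inf (J n)"
      using ev
    proof eventually_elim
      case (elim n)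
      then show ?case using J[of n] cube[of n] by (intro cInf_greatest) auto
    qed
    show "\<forall>\<^sub>F n in sequentially. Inf (J n) \<le> 1"
      using ev
    proof eventually_elim
      case (elim n)
      interpret log_concave n "cube_measure n" by standard (rule log_concave_prob_cube)
      obtain v where v: "v \<in> I n (cube_measure n)" using I_ne by blast
      \<comment> \<open>An element bounds a real infimum from above only when the set is bounded
        below. That bound is taken from \<open>J\<close> and \<open>lower\<close>, so the upper
        estimate is also an eventual one.\<close>
      have "Inf (J n) \<le> Inf (I n (cube_measure n))"
        using J[of n] elim cube by (intro cInf_lower bdd_belowI) auto
      also have "\<dots> \<le> v"
        using lower[of n "cube_measure n"] elim log_concave_prob_cube barycenter_origin_cube v
        by (intro cInf_lower bdd_belowI) auto
      also have "v \<le> 1" using v expected_cover_le_1 unfolding I_def by auto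
      finally show ?case .
    qed
  qed simp
  then show "(\<lambda>n::nat. Inf {Inf {expected_cover \<mu> N d | N::nat.
                         real N \<ge> exp (18 * (1 / d) * ln (2 / d) * real n * ln (real n))}
                   | \<mu>. log_concave_prob n \<mu> \<and> barycenter_origin n \<mu>})
    \<longlonglongrightarrow> 1" unfolding I_def J_def .
qed simp

end
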